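(* Let $G=(V,E)$ be a simple undirected graph with $V=\{1,\dots,n\}$. The polynomial system over $\mathbb{F}_2$ encoding the $3$-colorability of $G$, $$J_G=\{x_i^3+1=0,\ \ x_i^2+x_ix_j+x_j^2=0 \ :\ i\in V,\ \{i,j\}\in E\},$$ has a degree one Nullstellensatz certificate of infeasibility if and only if there exists a set $C$ of oriented partial $3$-cycles and oriented chordless $4$-cycles from $\mathrm{Arcs}(G)$ such that (1) $|C_{(i,j)}|+|C_{(j,i)}|\equiv 0 \pmod 2$ for all $\{i,j\}\in E$, and (2) $\sum_{(i,j)\in \mathrm{Arcs}(G),\, i<j}|C_{(i,j)}|\equiv 1\pmod 2$, where $C_{(i,j)}$ denotes the set of cycles in $C$ in which the arc $(i,j)\in \mathrm{Arcs}(G)$ appears. Moreover, the class of non-3-colorable graphs $G$ whose encodings $J_G$ have degree one Nullstellensatz infeasibility certificates can be recognized in polynomial time.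
   Context: $\mathrm{Arcs}(G)=\{(i,j): i,j\in V,\ \{i,j\}\in E\}$ (both orientations of each edge). A degree one Nullstellensatz certificate of infeasibility for $J_G$ is an identity in $\mathbb{F}_2[x_1,\dots,x_n]$ of the form $$\sum_{i\in V}\Big(a_i+\sum_{j\in V}a_{ij}x_j\Big)(x_i^3+1)+\sum_{\{i,j\}\in E}\Big(b_{ij}+\sum_{k\in V}b_{ijk}x_k\Big)(x_i^2+x_ix_j+x_j^2)=1$$ with all coefficients $a_i,a_{ij},b_{ij},b_{ijk}\in\mathbb{F}_2$. An oriented partial $3$-cycle is a pair of arcs $\{(i,j),(j,k)\}\subseteq \mathrm{Arcs}(G)$, denoted $(i,j,k)$, such that $(k,i)\in\mathrm{Arcs}(G)$; its arcs are $(i,j)$ and $(j,k)$ only. An oriented chordless $4$-cycle is a set of four arcs $\{(i,j),(j,k),(k,l),(l,i)\}\subseteq\mathrm{Arcs}(G)$, denoted $(i,j,k,l)$, with $i,j,k,l$ distinct and $(i,k),(j,l)\notin\mathrm{Arcs}(G)$. "Recognized in polynomial time" means that there is an algorithm which, given a simple undirected graph $G$, decides in time polynomial in the size of $G$ whether $J_G$ has a degree one Nullstellensatz certificate. *)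

theory Defs
  imports
    "HOL-Library.Poly_Mapping"
    "HOL-Library.Z2"
    "HOL-Computational_Algebra.Polynomial"
    "HOL-Number_Theory.Cong"
begin

section \<open>Simple graphs on the vertex set $1, \ldots, n$\<close>

definition vertices :: "nat \<Rightarrow> nat set" where
  "vertices n = {1..n}"

definition simple_graph :: "nat \<Rightarrow> nat set set \<Rightarrow> bool" where
  "simple_graph n E \<longleftrightarrow> E \<subseteq> {{i, j} | i j. i \<in> vertices n \<and> j \<in> vertices n \<and> i \<noteq> j}"

definition Arcs :: "nat \<Rightarrow> nat set set \<Rightarrow> (nat \<times> nat) set" where
  "Arcs n E = {(i, j). i \<in> vertices n \<and> j \<in> vertices n \<and> {i, j} \<in> E}"

definition three_colorable :: "nat \<Rightarrow> nat set set \<Rightarrow> bool" where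
  "three_colorable n E \<longleftrightarrow>
     (\<exists>c :: nat \<Rightarrow> nat. (\<forall>i \<in> vertices n. c i \<in> {0, 1, 2}) \<and> (\<forall>(i, j) \<in> Arcs n E. c i \<noteq> c j))"


section \<open>The polynomial encoding and its degree one certificates\<close>

text \<open>
  Polynomials over the two-element field \<^typ>\<open>bit\<close>, in variables indexed by the naturals: a monomial
  maps each variable to its exponent, a polynomial maps each monomial to its coefficient, and the
  ring structure is the convolution product of \<^theory>\<open>HOL-Library.Poly_Mapping\<close>. Only the variables
  with index in \<^term>\<open>vertices n\<close> are ever used below.
\<close>

type_synonym f2poly = "(nat \<Rightarrow>\<^sub>0 nat) \<Rightarrow>\<^sub>0 bit"

definition Const :: "bit \<Rightarrow> f2poly" where
  "Const a = Poly_Mapping.single 0 a"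

definition X :: "nat \<Rightarrow> f2poly" where
  "X i = Poly_Mapping.single (Poly_Mapping.single i 1) 1"

definition vertex_poly :: "nat \<Rightarrow> f2poly" where
  "vertex_poly i = X i ^ 3 + 1"

text \<open>
  For an edge \<open>{i, j}\<close>, \<^const>\<open>Min\<close> and \<^const>\<open>Max\<close> just name its two ends; the polynomial is
  symmetric in them.
\<close>

definition edge_poly :: "nat set \<Rightarrow> f2poly" where
  "edge_poly e = X (Min e) ^ 2 + X (Min e) * X (Max e) + X (Max e) ^ 2"

lemma edge_poly_doubleton: "edge_poly {i, j} = X i ^ 2 + X i * X j + X j ^ 2"
  by (cases "i \<le> j") (simp_all add: edge_poly_def max_def min_def ac_simps)

definition has_degree_one_certificate :: "nat \<Rightarrow> nat set set \<Rightarrow> bool" where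
  "has_degree_one_certificate n E \<longleftrightarrow>
     (\<exists>(a :: nat \<Rightarrow> bit) (a' :: nat \<Rightarrow> nat \<Rightarrow> bit) (b :: nat set \<Rightarrow> bit) (b' :: nat set \<Rightarrow> nat \<Rightarrow> bit).
        (\<Sum>i \<in> vertices n. (Const (a i) + (\<Sum>j \<in> vertices n. Const (a' i j) * X j)) * vertex_poly i)
      + (\<Sum>e \<in> E. (Const (b e) + (\<Sum>k \<in> vertices n. Const (b' e k) * X k)) * edge_poly e) = 1)"


section \<open>Oriented partial 3-cycles and oriented chordless 4-cycles\<close>

text \<open>Both kinds of cycles are identified with their sets of arcs.\<close>

definition partial_3_cycles :: "nat \<Rightarrow> nat set set \<Rightarrow> (nat \<times> nat) set set" where
  "partial_3_cycles n E =
     {{(i, j), (j, k)} | i j k. {(i, j), (j, k)} \<subseteq> Arcs n E \<and> (k, i) \<in> Arcs n E}"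

definition chordless_4_cycles :: "nat \<Rightarrow> nat set set \<Rightarrow> (nat \<times> nat) set set" where
  "chordless_4_cycles n E =
     {{(i, j), (j, k), (k, l), (l, i)} | i j k l.
        {(i, j), (j, k), (k, l), (l, i)} \<subseteq> Arcs n E \<and> distinct [i, j, k, l] \<and>
        (i, k) \<notin> Arcs n E \<and> (j, l) \<notin> Arcs n E}"

definition cycles_through :: "(nat \<times> nat) set set \<Rightarrow> nat \<times> nat \<Rightarrow> (nat \<times> nat) set set" where
  "cycles_through C arc = {c \<in> C. arc \<in> c}"


section \<open>Polynomial time on a random access machine\<close>

text \<open>
  The machine has registers and a memory, both holding natural numbers. Its programs are structured
  (loops instead of jumps), and every instruction and every test takes one unit of time. Addition and
  truncated subtraction are the only arithmetic operations, so the bit length of the largest stored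
  number grows by at most one per time unit (up to the constants of the program); polynomial time on
  this machine is therefore the same as polynomial time on Turing machines. With a unit-cost
  multiplication this would fail.
\<close>

datatype prog =
    Set nat nat            \<comment> \<open>\<open>Set d c\<close>: register \<open>d\<close> becomes the constant \<open>c\<close>\<close>
  | Add nat nat nat        \<comment> \<open>\<open>Add d s t\<close>: register \<open>d\<close> becomes the sum of registers \<open>s\<close> and \<open>t\<close>\<close>
  | Sub nat nat nat
  | Load nat nat           \<comment> \<open>\<open>Load d s\<close>: register \<open>d\<close> becomes the memory cell addressed by register \<open>s\<close>\<close>
  | Store nat nat          \<comment> \<open>\<open>Store d s\<close>: the memory cell addressed by register \<open>d\<close> becomes register \<open>s\<close>\<close>
  | Seq prog prog
  | IfNZ nat prog prog
  | WhileNZ nat prog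

type_synonym config = "(nat \<Rightarrow> nat) \<times> (nat \<Rightarrow> nat)"

text \<open>
  \<open>runs p s t s'\<close>: started in configuration \<open>s\<close> (registers, memory), program \<open>p\<close> halts after exactly
  \<open>t\<close> time units in configuration \<open>s'\<close>.
\<close>

inductive runs :: "prog \<Rightarrow> config \<Rightarrow> nat \<Rightarrow> config \<Rightarrow> bool" where
  Set: "runs (Set d c) (r, m) 1 (r(d := c), m)"
| Add: "runs (Add d s t) (r, m) 1 (r(d := r s + r t), m)"
| Sub: "runs (Sub d s t) (r, m) 1 (r(d := r s - r t), m)"
| Load: "runs (Load d s) (r, m) 1 (r(d := m (r s)), m)"
| Store: "runs (Store d s) (r, m) 1 (r, m(r d := r s))"
| Seq: "runs p s t s' \<Longrightarrow> runs q s' t' s'' \<Longrightarrow> runs (Seq p q) s (t + t') s''"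
| IfTrue: "fst s x \<noteq> 0 \<Longrightarrow> runs p s t s' \<Longrightarrow> runs (IfNZ x p q) s (1 + t) s'"
| IfFalse: "fst s x = 0 \<Longrightarrow> runs q s t s' \<Longrightarrow> runs (IfNZ x p q) s (1 + t) s'"
| WhileFalse: "fst s x = 0 \<Longrightarrow> runs (WhileNZ x p) s 1 s"
| WhileTrue: "fst s x \<noteq> 0 \<Longrightarrow> runs p s t s' \<Longrightarrow> runs (WhileNZ x p) s' t' s'' \<Longrightarrow>
    runs (WhileNZ x p) s (1 + t + t') s''"

lemma runs_deterministic:
  "runs p s t s' \<Longrightarrow> runs p s u s'' \<Longrightarrow> t = u \<and> s' = s''"
proof (induction arbitrary: u s'' rule: runs.induct)
  case (Set d c r m)
  then show ?case by (cases rule: runs.cases) auto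
next
  case (Add d s t r m)
  then show ?case by (cases rule: runs.cases) auto
next
  case (Sub d s t r m)
  then show ?case by (cases rule: runs.cases) auto
next
  case (Load d s r m)
  then show ?case by (cases rule: runs.cases) auto
next
  case (Store d s r m)
  then show ?case by (cases rule: runs.cases) auto
next
  case (Seq p s t s' q t' s1)
  from Seq.prems obtain v v' w where "runs p s v w" "runs q w v' s''" "u = v + v'"
    by (cases rule: runs.cases) auto
  with Seq.IH show ?case by metis
next
  case (IfTrue s x p t s' q)
  from IfTrue.prems IfTrue.hyps obtain v where "runs p s v s''" "u = 1 + v"
    by (cases rule: runs.cases) auto
  with IfTrue.IH show ?case by metis
next
  case (IfFalse s x q t s' p)
  from IfFalse.prems IfFalse.hyps obtain v where "runs q s v s''" "u = 1 + v"
    by (cases rule: runs.cases) auto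
  with IfFalse.IH show ?case by metis
next
  case (WhileFalse s x p)
  from WhileFalse.prems WhileFalse.hyps show ?case
    by (cases rule: runs.cases) auto
next
  case (WhileTrue s x p t s' t' s1)
  from WhileTrue.prems WhileTrue.hyps obtain v v' w
    where "runs p s v w" "runs (WhileNZ x p) w v' s''" "u = 1 + v + v'"
    by (cases rule: runs.cases) auto
  with WhileTrue.IH show ?case by metis
qed

text \<open>
  The input: register 0 holds \<open>n\<close>, the first \<open>n * n\<close> memory cells hold the adjacency matrix row by
  row, everything else is 0.
\<close>

definition input_config :: "nat \<Rightarrow> nat set set \<Rightarrow> config" where
  "input_config n E =
     ((\<lambda>_. 0)(0 := n),
      (\<lambda>a. if a < n * n \<and> {a div n + 1, a mod n + 1} \<in> E then 1 else 0))"

definition graph_size :: "nat \<Rightarrow> nat set set \<Rightarrow> nat" where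
  "graph_size n E = card (vertices n) + card E"

text \<open>The machine accepts iff it halts with a nonzero value in register 0.\<close>

definition recognizable_in_polynomial_time :: "(nat \<Rightarrow> nat set set \<Rightarrow> bool) \<Rightarrow> bool" where
  "recognizable_in_polynomial_time P \<longleftrightarrow>
     (\<exists>(p :: prog) (bound :: nat poly). \<forall>n E. simple_graph n E \<longrightarrow>
        (\<exists>t r m. runs p (input_config n E) t (r, m) \<and>
           t \<le> poly bound (graph_size n E) \<and> (r 0 \<noteq> 0 \<longleftrightarrow> P n E)))"

end

theory Submission
  imports Defs
begin

text \<open>
  Everything is reduced by linear duality over the two-element field to potentials on pairs of
  vertices. Splitting a certificate by degree modulo 3, only the multiples of \<open>x\<^sub>i\<^sup>3 + 1\<close> and of
  \<open>x\<^sub>k (x\<^sub>i\<^sup>2 + x\<^sub>i x\<^sub>j + x\<^sub>j\<^sup>2)\<close> matter, so a certificate fails to exist iff some linear functional \<open>\<lambda>\<close>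
  with \<open>\<lambda> 1 = 1\<close> kills all of these. Writing \<open>w (i, j) = \<lambda> (x\<^sub>i x\<^sub>j\<^sup>2)\<close> and eliminating the values
  \<open>\<lambda> (x\<^sub>i x\<^sub>j x\<^sub>k)\<close>, this becomes \<open>w (i, j) + w (j, k) + w (i, k) + w (k, i) = 1\<close> for all walks
  \<open>i, j, k\<close>. On the other side, a family of cycles as in the theorem fails to exist iff there is a
  function \<open>u\<close> on the arcs with \<open>u (i, j) + u (j, i) = 1\<close> whose sum over each admissible cycle is 0.
  The restriction of \<open>w\<close> to the arcs is such a \<open>u\<close>; conversely the 4-cycle conditions say exactly that
  \<open>w (i, k) + w (k, i) = 1 + u (i, j) + u (j, k)\<close>, for a non-arc \<open>(i, k)\<close>, does not depend on the
  common neighbour \<open>j\<close>.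

  The walk equations form a linear system in polynomially many unknowns, which the random access
  machine solves by keeping a spanning set of the solution space of the (homogenised) equations
  processed so far. Since a 3-colouring yields a potential \<open>u\<close>, graphs with a certificate are never
  3-colourable, and the two decision problems of the theorem coincide.
\<close>

section \<open>Linear algebra over the two-element field\<close>

declare add_bit_eq_xor [simp del] mult_bit_eq_and [simp del]

lemma bit_add_self [simp]: "b + b = 0" for b :: bit
  by (cases b) simp_all

lemma bit_add_self_left [simp]: "b + (b + c) = c" for b c :: bit
  by (simp flip: add.assoc)

lemma bit_add_eq_0_iff [simp]: "b + c = 0 \<longleftrightarrow> b = c" for b c :: bit
  by (cases b; cases c) simp_all

lemma bit_add_eq_1_iff: "b + c = 1 \<longleftrightarrow> b = c + 1" for b c :: bit
  by (cases b; cases c) simp_all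

lemma of_nat_bit_eq_iff: "of_nat a = (of_nat b :: bit) \<longleftrightarrow> [a = b] (mod 2)"
proof -
  have "of_nat c = (of_bool (odd c) :: bit)" for c
    by (induction c) auto
  then show ?thesis
    by (auto simp: cong_def odd_iff_mod_2_eq_one)
qed

text \<open>Induction on \<open>I\<close>. The coefficient of a new vector \<open>v i\<close> is 0
  or 1, so if \<open>t\<close> is no combination even with its help, then neither \<open>t\<close>
  nor \<open>v i + t\<close> is a combination of the earlier vectors. The induction hypothesis
  yields a functional for each of the two, and one of them or their sum also kills
  \<open>v i\<close>.\<close>

lemma Fredholm_alternative_bit:
  fixes v :: "'i \<Rightarrow> 'x \<Rightarrow> bit" and t :: "'x \<Rightarrow> bit"
  assumes "finite I" "finite Q"
    and unsolvable: "\<nexists>c. \<forall>x\<in>Q. (\<Sum>i\<in>I. c i * v i x) = t x"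
  shows "\<exists>y. (\<forall>i\<in>I. (\<Sum>x\<in>Q. y x * v i x) = 0) \<and> (\<Sum>x\<in>Q. y x * t x) = 1"
  using \<open>finite I\<close> unsolvable
proof (induction I arbitrary: t rule: finite_induct)
  case empty
  then obtain x where x: "x \<in> Q" "t x = 1"
    by fastforce
  have "(\<Sum>x'\<in>Q. of_bool (x' = x) * t x') = 1"
    using x \<open>finite Q\<close> by simp
  then show ?case
    by (intro exI[of _ "\<lambda>x'. of_bool (x' = x)"]) simp
next
  case (insert i I)
  have split: "(\<Sum>k\<in>insert i I. (c(i := b)) k * v k x) = b * v i x + (\<Sum>k\<in>I. c k * v k x)"
    for c b x
  proof -
    have "(\<Sum>k\<in>I. (c(i := b)) k * v k x) = (\<Sum>k\<in>I. c k * v k x)"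
      using insert.hyps by (intro sum.cong) auto
    then show ?thesis
      using insert.hyps by simp
  qed
  have "\<nexists>c. \<forall>x\<in>Q. (\<Sum>k\<in>I. c k * v k x) = t x"
  proof
    assume "\<exists>c. \<forall>x\<in>Q. (\<Sum>k\<in>I. c k * v k x) = t x"
    then obtain c where c: "\<forall>x\<in>Q. (\<Sum>k\<in>I. c k * v k x) = t x" ..
    have "\<forall>x\<in>Q. (\<Sum>k\<in>insert i I. (c(i := 0)) k * v k x) = t x"
      unfolding split using c by simp
    with insert.prems show False
      by blast
  qed
  from insert.IH[OF this] obtain y where
    y: "\<forall>k\<in>I. (\<Sum>x\<in>Q. y x * v k x) = 0" "(\<Sum>x\<in>Q. y x * t x) = 1"
    by blast
  have "\<nexists>c. \<forall>x\<in>Q. (\<Sum>k\<in>I. c k * v k x) = v i x + t x"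
  proof
    assume "\<exists>c. \<forall>x\<in>Q. (\<Sum>k\<in>I. c k * v k x) = v i x + t x"
    then obtain c where c: "\<forall>x\<in>Q. (\<Sum>k\<in>I. c k * v k x) = v i x + t x" ..
    have "\<forall>x\<in>Q. (\<Sum>k\<in>insert i I. (c(i := 1)) k * v k x) = t x"
      unfolding split using c by simp
    with insert.prems show False
      by blast
  qed
  from insert.IH[OF this] obtain z where
    z: "\<forall>k\<in>I. (\<Sum>x\<in>Q. z x * v k x) = 0" "(\<Sum>x\<in>Q. z x * (v i x + t x)) = 1"
    by blast
  have z_sum: "(\<Sum>x\<in>Q. z x * v i x) + (\<Sum>x\<in>Q. z x * t x) = 1"
    using z(2) by (simp add: distrib_left sum.distrib)
  consider "(\<Sum>x\<in>Q. y x * v i x) = 0" | "(\<Sum>x\<in>Q. z x * v i x) = 0"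
    | "(\<Sum>x\<in>Q. y x * v i x) = 1" "(\<Sum>x\<in>Q. z x * v i x) = 1"
    by (metis bit_not_zero_iff)
  then show ?case
  proof cases
    case 1
    with y show ?thesis by auto
  next
    case 2
    with z z_sum show ?thesis by auto
  next
    \<comment> \<open>Both \<open>y\<close> and \<open>z\<close> take the value 1 on
      \<open>v i\<close>, so \<open>y + z\<close> kills it. By \<open>z_sum\<close>,
      \<open>z\<close> is 0 on \<open>t\<close>, so \<open>y + z\<close> keeps the value 1
      there.\<close>
    case 3
    with y z z_sum show ?thesis
      by (intro exI[of _ "\<lambda>x. y x + z x"]) (simp add: distrib_right sum.distrib)
  qed
qed

section \<open>Families of cycles and potentials\<close>

definition arc_potential :: "nat \<Rightarrow> nat set set \<Rightarrow> (nat \<times> nat \<Rightarrow> bit) \<Rightarrow> bool" where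
  "arc_potential n E u \<longleftrightarrow>
     (\<forall>(i, j) \<in> Arcs n E. u (i, j) + u (j, i) = 1) \<and>
     (\<forall>c \<in> partial_3_cycles n E \<union> chordless_4_cycles n E. (\<Sum>a\<in>c. u a) = 0)"

lemma edge_ends:
  assumes "simple_graph n E" "{i, j} \<in> E"
  shows "i \<noteq> j" "i \<in> vertices n" "j \<in> vertices n"
proof -
  have "{i, j} \<in> {{i, j} | i j. i \<in> vertices n \<and> j \<in> vertices n \<and> i \<noteq> j}"
    using assms unfolding simple_graph_def by (rule subsetD)
  then show "i \<noteq> j" "i \<in> vertices n" "j \<in> vertices n"
    by (auto simp: doubleton_eq_iff)
qed

lemma edgeE:
  assumes "simple_graph n E" "e \<in> E"
  obtains i j where "e = {i, j}"
proof -
  have "e \<in> {{i, j} | i j. i \<in> vertices n \<and> j \<in> vertices n \<and> i \<noteq> j}"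
    using assms unfolding simple_graph_def by (rule subsetD)
  then show thesis
    using that by auto
qed

lemma Arcs_iff:
  assumes "simple_graph n E"
  shows "(i, j) \<in> Arcs n E \<longleftrightarrow> {i, j} \<in> E"
  using edge_ends[OF assms] unfolding Arcs_def by auto

lemma Arcs_swap: "(i, j) \<in> Arcs n E \<Longrightarrow> (j, i) \<in> Arcs n E"
  by (simp add: Arcs_def insert_commute)

lemma Arcs_irrefl:
  assumes "simple_graph n E"
  shows "(i, i) \<notin> Arcs n E"
  using edge_ends(1)[OF assms, of i i] by (auto simp: Arcs_def)

lemma finite_Arcs: "finite (Arcs n E)"
  by (rule finite_subset[of _ "vertices n \<times> vertices n"]) (auto simp: Arcs_def vertices_def)

lemma finite_edges:
  assumes "simple_graph n E"
  shows "finite E"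
proof (rule finite_subset)
  show "E \<subseteq> Pow (vertices n)"
    using assms by (auto simp: simple_graph_def)
qed (simp add: vertices_def)

lemma cycles_subset_Arcs:
  "c \<in> partial_3_cycles n E \<union> chordless_4_cycles n E \<Longrightarrow> c \<subseteq> Arcs n E"
  by (auto simp: partial_3_cycles_def chordless_4_cycles_def)

lemma finite_cycle:
  "c \<in> partial_3_cycles n E \<union> chordless_4_cycles n E \<Longrightarrow> finite c"
  by (auto simp: partial_3_cycles_def chordless_4_cycles_def)

lemma finite_cycles: "finite (partial_3_cycles n E \<union> chordless_4_cycles n E)"
proof (rule finite_subset)
  show "partial_3_cycles n E \<union> chordless_4_cycles n E \<subseteq> Pow (Arcs n E)"
    using cycles_subset_Arcs by blast
qed (simp add: finite_Arcs)

lemma sum_Arcs: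
  fixes g :: "nat \<times> nat \<Rightarrow> 'a::comm_monoid_add"
  assumes "simple_graph n E"
  shows "sum g (Arcs n E) = (\<Sum>(i, j)\<in>{(i, j) \<in> Arcs n E. i < j}. g (i, j) + g (j, i))"
proof -
  let ?A = "{(i, j) \<in> Arcs n E. i < j}"
  have "Arcs n E = ?A \<union> prod.swap ` ?A"
  proof (rule set_eqI, rule prod.induct)
    fix i j
    have "i \<noteq> j" if "(i, j) \<in> Arcs n E"
      using that Arcs_irrefl[OF assms] by auto
    moreover have "(i, j) \<in> prod.swap ` ?A \<longleftrightarrow> (j, i) \<in> ?A"
      by (auto simp: image_iff)
    ultimately show "(i, j) \<in> Arcs n E \<longleftrightarrow> (i, j) \<in> ?A \<union> prod.swap ` ?A"
      using Arcs_swap[of i j] Arcs_swap[of j i] by (auto simp: neq_iff)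
  qed
  moreover have "?A \<inter> prod.swap ` ?A = {}"
    by auto
  moreover have "finite ?A"
    by (rule finite_subset[OF _ finite_Arcs]) auto
  ultimately have "sum g (Arcs n E) = sum g ?A + sum g (prod.swap ` ?A)"
    by (metis (no_types, lifting) finite_imageI sum.union_disjoint)
  also have "sum g (prod.swap ` ?A) = (\<Sum>a\<in>?A. g (prod.swap a))"
    by (subst sum.reindex) (auto simp: inj_on_def)
  finally show ?thesis
    by (simp add: sum.distrib case_prod_unfold prod.swap_def)
qed

text \<open>Forward: sum \<open>u a\<close> over all arcs of all cycles in \<open>C\<close>. Cycle
  by cycle the total is 0; edge by edge, condition (1) and \<open>u (i, j) + u (j, i) = 1\<close>
  turn it into the sum of condition (2), which is 1. Backward: the two conditions form a linear
  system for the indicator of \<open>C\<close>, and a functional witnessing its unsolvability yields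
  a potential.\<close>

lemma cycle_family_iff_no_arc_potential:
  assumes G: "simple_graph n E"
  shows "(\<exists>C. C \<subseteq> partial_3_cycles n E \<union> chordless_4_cycles n E \<and>
            (\<forall>i j. {i, j} \<in> E \<longrightarrow>
              [card (cycles_through C (i, j)) + card (cycles_through C (j, i)) = 0] (mod 2)) \<and>
            [(\<Sum>(i, j) \<in> {(i, j) \<in> Arcs n E. i < j}. card (cycles_through C (i, j))) = 1] (mod 2))
         \<longleftrightarrow> (\<nexists>u. arc_potential n E u)"
    (is "(\<exists>C. ?family C) \<longleftrightarrow> _")
proof -
  let ?K = "partial_3_cycles n E \<union> chordless_4_cycles n E"
  let ?A = "{(i, j) \<in> Arcs n E. i < j}"
  have card_through: "(of_nat (card (cycles_through C a)) :: bit) = (\<Sum>c\<in>C. of_bool (a \<in> c))"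
    if "C \<subseteq> ?K" for C a
  proof -
    have "finite C"
      using that finite_cycles finite_subset by blast
    then show ?thesis
      by (simp add: cycles_through_def of_bool_def sum.If_cases Int_def)
  qed
  show ?thesis
  proof (intro iffI notI)
    assume "\<exists>C. ?family C" and "\<exists>u. arc_potential n E u"
    then obtain C u where C: "?family C" and u: "arc_potential n E u"
      by blast
    define N where "N a = (of_nat (card (cycles_through C a)) :: bit)" for a
    have "N (i, j) = N (j, i)" if "{i, j} \<in> E" for i j
      using C that unfolding N_def by (auto simp flip: of_nat_bit_eq_iff)
    then have sym: "N (j, i) = N (i, j)" if "(i, j) \<in> Arcs n E" for i j
      using that unfolding Arcs_iff[OF G] by metis
    have "0 = (\<Sum>c\<in>C. \<Sum>a\<in>c. u a)"
      using C u by (intro sum.neutral[symmetric]) (auto simp: arc_potential_def)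
    also have "\<dots> = (\<Sum>c\<in>C. \<Sum>a\<in>Arcs n E. of_bool (a \<in> c) * u a)"
    proof (rule sum.cong[OF refl])
      fix c assume "c \<in> C"
      then have "c \<subseteq> Arcs n E"
        using C cycles_subset_Arcs by blast
      then show "(\<Sum>a\<in>c. u a) = (\<Sum>a\<in>Arcs n E. of_bool (a \<in> c) * u a)"
        using finite_Arcs by (intro sum.mono_neutral_cong_left) auto
    qed
    also have "\<dots> = (\<Sum>a\<in>Arcs n E. N a * u a)"
      unfolding N_def using C by (subst sum.swap) (simp add: card_through sum_distrib_right)
    also have "\<dots> = (\<Sum>(i, j)\<in>?A. N (i, j) * u (i, j) + N (j, i) * u (j, i))"
      by (rule sum_Arcs[OF G])
    also have "\<dots> = (\<Sum>(i, j)\<in>?A. N (i, j))"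
      using u by (intro sum.cong) (auto simp: sym arc_potential_def simp flip: distrib_left)
    also have "\<dots> = of_nat (\<Sum>(i, j)\<in>?A. card (cycles_through C (i, j)))"
      by (simp add: N_def case_prod_unfold)
    also have "\<dots> = of_nat 1"
      using C unfolding of_nat_bit_eq_iff by blast
    finally show False
      by simp
  next
    assume no_pot: "\<nexists>u. arc_potential n E u"
    \<comment> \<open>\<open>None\<close> indexes the equation of condition (2),
      \<open>Some e\<close> that of condition (1) at the edge \<open>e\<close>. \<open>v c\<close>
      is the column of the cycle \<open>c\<close>, and \<open>t\<close> is the right-hand
      side.\<close>
    define Q where "Q = insert None (Some ` E)"
    define edge where "edge = (\<lambda>(i::nat, j). {i, j})"
    define v where "v c x = (case x of None \<Rightarrow> \<Sum>(i, j)\<in>c. of_bool (i < j)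
        | Some e \<Rightarrow> \<Sum>a\<in>c. (of_bool (edge a = e) :: bit))" for c and x :: "nat set option"
    have finQ: "finite Q"
      using finite_edges[OF G] by (simp add: Q_def)
    define t where "t x = (of_bool (x = None) :: bit)" for x :: "nat set option"
    have v_sum: "(\<Sum>x\<in>Q. y x * v c x) =
        (\<Sum>(i, j)\<in>c. y None * of_bool (i < j) + y (Some {i, j}))" if "c \<in> ?K" for y c
    proof -
      have c: "c \<subseteq> Arcs n E" "finite c"
        by (rule cycles_subset_Arcs[OF that] finite_cycle[OF that])+
      have "(\<Sum>e\<in>E. y (Some e) * v c (Some e)) = (\<Sum>a\<in>c. \<Sum>e\<in>E. y (Some e) * of_bool (edge a = e))"
        unfolding v_def option.case sum_distrib_left by (rule sum.swap)
      also have "\<dots> = (\<Sum>a\<in>c. y (Some (edge a)))"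
      proof (rule sum.cong[OF refl])
        fix a assume "a \<in> c"
        then have "edge a \<in> E"
          using c(1) by (auto simp: edge_def Arcs_def)
        then show "(\<Sum>e\<in>E. y (Some e) * of_bool (edge a = e)) = y (Some (edge a))"
          using finite_edges[OF G] by simp
      qed
      finally have "(\<Sum>e\<in>E. y (Some e) * v c (Some e)) = (\<Sum>a\<in>c. y (Some (edge a)))" .
      moreover have "(\<Sum>x\<in>Q. y x * v c x) = y None * v c None + (\<Sum>e\<in>E. y (Some e) * v c (Some e))"
        using finite_edges[OF G] by (simp add: Q_def sum.reindex)
      moreover have "v c None = (\<Sum>(i, j)\<in>c. of_bool (i < j))"
        by (simp add: v_def)
      ultimately show ?thesis
        by (simp only: sum_distrib_left sum.distrib case_prod_unfold edge_def)
    qed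
    have "\<exists>f. \<forall>x\<in>Q. (\<Sum>c\<in>?K. f c * v c x) = t x"
    proof (rule ccontr)
      assume "\<nexists>f. \<forall>x\<in>Q. (\<Sum>c\<in>?K. f c * v c x) = t x"
      from Fredholm_alternative_bit[OF finite_cycles finQ this] obtain y where
        y: "\<forall>c\<in>?K. (\<Sum>x\<in>Q. y x * v c x) = 0" "(\<Sum>x\<in>Q. y x * t x) = 1"
        by blast
      have "(\<Sum>x\<in>Q. y x * t x) = y None"
        using finQ by (simp add: t_def Q_def)
      with y have "y None = 1"
        by simp
      \<comment> \<open>The values \<open>y (Some {i, j})\<close> are symmetric in the two ends and
        cancel; since \<open>i \<noteq> j\<close>, the term \<open>of_bool (i < j)\<close> coming
        from \<open>y None = 1\<close> is 1 on exactly one of the two orientations. The cycle sums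
        are \<open>v_sum\<close>.\<close>
      have "arc_potential n E (\<lambda>(i, j). of_bool (i < j) + y (Some {i, j}))"
        unfolding arc_potential_def
      proof (intro conjI ballI)
        fix a assume "a \<in> Arcs n E"
        moreover obtain i j where a: "a = (i, j)"
          by (cases a)
        ultimately have "i \<noteq> j"
          using Arcs_irrefl[OF G] by auto
        then show "case a of (i, j) \<Rightarrow> (case (i, j) of (i, j) \<Rightarrow> of_bool (i < j) + y (Some {i, j})) +
            (case (j, i) of (i, j) \<Rightarrow> of_bool (i < j) + y (Some {i, j})) = 1"
          unfolding a by (cases "i < j") (simp_all add: insert_commute bit_add_eq_1_iff ac_simps)
      next
        fix c assume "c \<in> ?K"
        with y(1) v_sum[of c y] \<open>y None = 1\<close>
        show "(\<Sum>a\<in>c. case a of (i, j) \<Rightarrow> of_bool (i < j) + y (Some {i, j})) = 0"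
          by simp
      qed
      with no_pot show False
        by blast
    qed
    then obtain f where f: "\<forall>x\<in>Q. (\<Sum>c\<in>?K. f c * v c x) = t x" ..
    \<comment> \<open>A solution with coefficients in the two-element field is the indicator of a
      subfamily.\<close>
    define C where "C = {c \<in> ?K. f c = 1}"
    have CK: "C \<subseteq> ?K"
      by (auto simp: C_def)
    have f_sum: "(\<Sum>c\<in>?K. f c * h c) = (\<Sum>c\<in>C. h c)" for h :: "_ \<Rightarrow> bit"
    proof -
      have "(\<Sum>c\<in>?K. f c * h c) = (\<Sum>c\<in>?K. if f c = 1 then h c else 0)"
        by (intro sum.cong) auto
      then show ?thesis
        unfolding C_def by (simp only: sum.inter_filter[OF finite_cycles])
    qed
    have CA: "c \<subseteq> Arcs n E" "finite c" if "c \<in> C" for c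
      using that CK cycles_subset_Arcs[of c] finite_cycle[of c] by blast+
    have "[card (cycles_through C (i, j)) + card (cycles_through C (j, i)) = 0] (mod 2)"
      if "{i, j} \<in> E" for i j
    proof -
      have "i \<noteq> j"
        using that Arcs_irrefl[OF G] by (auto simp: Arcs_iff[OF G])
      have "(\<Sum>a\<in>c. of_bool (edge a = {i, j})) = (of_bool ((i, j) \<in> c) + of_bool ((j, i) \<in> c) :: bit)"
        if "c \<in> C" for c
      proof -
        have "(\<Sum>a\<in>c. of_bool (edge a = {i, j})) = (\<Sum>a\<in>c. of_bool (a = (i, j)) + (of_bool (a = (j, i)) :: bit))"
          using \<open>i \<noteq> j\<close> by (intro sum.cong) (auto simp: edge_def doubleton_eq_iff)
        then show ?thesis
          using CA(2)[OF that] by (simp add: sum.distrib)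
      qed
      then have "(\<Sum>c\<in>C. of_bool ((i, j) \<in> c) + of_bool ((j, i) \<in> c)) = (0 :: bit)"
        using f[rule_format, of "Some {i, j}"] that by (simp add: f_sum Q_def t_def v_def)
      then have "of_nat (card (cycles_through C (i, j)) + card (cycles_through C (j, i))) = (of_nat 0 :: bit)"
        using CK by (simp add: sum.distrib card_through)
      then show ?thesis
        unfolding of_nat_bit_eq_iff .
    qed
    moreover have "[(\<Sum>(i, j)\<in>?A. card (cycles_through C (i, j))) = 1] (mod 2)"
    proof -
      have "of_nat (\<Sum>(i, j)\<in>?A. card (cycles_through C (i, j))) =
          (\<Sum>a\<in>?A. \<Sum>c\<in>C. (of_bool (a \<in> c) :: bit))"
        using CK by (simp add: case_prod_unfold card_through)
      also have "\<dots> = (\<Sum>c\<in>C. \<Sum>a\<in>?A. of_bool (a \<in> c))"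
        by (rule sum.swap)
      also have "\<dots> = (\<Sum>c\<in>C. v c None)"
      proof (rule sum.cong[OF refl])
        fix c assume "c \<in> C"
        have "finite ?A"
          by (rule finite_subset[OF _ finite_Arcs]) auto
        then have "(\<Sum>a\<in>?A. of_bool (a \<in> c)) = (\<Sum>a\<in>?A \<inter> c. (1 :: bit))"
          by (intro sum.mono_neutral_cong_right) auto
        also have "\<dots> = (\<Sum>(i, j)\<in>c. of_bool (i < j))"
          using CA[OF \<open>c \<in> C\<close>] by (intro sum.mono_neutral_cong_left) auto
        finally show "(\<Sum>a\<in>?A. of_bool (a \<in> c)) = v c None"
          by (simp add: v_def)
      qed
      also have "\<dots> = of_nat 1"
        using f[rule_format, of None] by (simp add: f_sum Q_def t_def)
      finally show ?thesis
        unfolding of_nat_bit_eq_iff .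
    qed
    ultimately have "?family C"
      using CK by blast
    then show "\<exists>C. ?family C" ..
  qed
qed

text \<open>Sums over cycles as sets of arcs become sums over listed arcs because the listed arcs
  differ: two equal consecutive arcs would be a loop, and the vertices of a 4-cycle are
  distinct.\<close>

lemma arc_potential_iff:
  assumes G: "simple_graph n E"
  shows "arc_potential n E u \<longleftrightarrow>
    (\<forall>(i, j) \<in> Arcs n E. u (i, j) + u (j, i) = 1) \<and>
    (\<forall>i j k. (i, j) \<in> Arcs n E \<longrightarrow> (j, k) \<in> Arcs n E \<longrightarrow> (k, i) \<in> Arcs n E \<longrightarrow>
      u (i, j) = u (j, k)) \<and>
    (\<forall>i j k l. (i, j) \<in> Arcs n E \<longrightarrow> (j, k) \<in> Arcs n E \<longrightarrow> (k, l) \<in> Arcs n E \<longrightarrow> (l, i) \<in> Arcs n E \<longrightarrow>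
      distinct [i, j, k, l] \<longrightarrow> (i, k) \<notin> Arcs n E \<longrightarrow> (j, l) \<notin> Arcs n E \<longrightarrow>
      u (i, j) + u (j, k) + u (k, l) + u (l, i) = 0)"
proof -
  have three: "(\<Sum>a\<in>{(i, j), (j, k)}. u a) = u (i, j) + u (j, k)" if "(i, j) \<in> Arcs n E" for i j k
    using that Arcs_irrefl[OF G, of i] by (cases "i = j") auto
  have four: "(\<Sum>a\<in>{(i, j), (j, k), (k, l), (l, i)}. u a) = u (i, j) + u (j, k) + u (k, l) + u (l, i)"
    if "distinct [i, j, k, l]" for i j k l
    using that by (auto simp: add.assoc)
  have "(\<forall>c \<in> partial_3_cycles n E. (\<Sum>a\<in>c. u a) = 0) \<longleftrightarrow>
    (\<forall>i j k. (i, j) \<in> Arcs n E \<longrightarrow> (j, k) \<in> Arcs n E \<longrightarrow> (k, i) \<in> Arcs n E \<longrightarrow> u (i, j) = u (j, k))"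
    (is "_ \<longleftrightarrow> ?R")
  proof
    assume L: "\<forall>c \<in> partial_3_cycles n E. (\<Sum>a\<in>c. u a) = 0"
    show ?R
    proof (intro allI impI)
      fix i j k assume a: "(i, j) \<in> Arcs n E" "(j, k) \<in> Arcs n E" "(k, i) \<in> Arcs n E"
      then have "{(i, j), (j, k)} \<in> partial_3_cycles n E"
        unfolding partial_3_cycles_def by blast
      with L three[OF a(1)] show "u (i, j) = u (j, k)"
        by (metis bit_add_eq_0_iff)
    qed
  next
    assume R: ?R
    show "\<forall>c \<in> partial_3_cycles n E. (\<Sum>a\<in>c. u a) = 0"
    proof
      fix c assume "c \<in> partial_3_cycles n E"
      then obtain i j k where c: "c = {(i, j), (j, k)}"
        "(i, j) \<in> Arcs n E" "(j, k) \<in> Arcs n E" "(k, i) \<in> Arcs n E"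
        unfolding partial_3_cycles_def by blast
      then show "(\<Sum>a\<in>c. u a) = 0"
        unfolding c(1) three[OF c(2)] bit_add_eq_0_iff using R by blast
    qed
  qed
  moreover have "(\<forall>c \<in> chordless_4_cycles n E. (\<Sum>a\<in>c. u a) = 0) \<longleftrightarrow>
    (\<forall>i j k l. (i, j) \<in> Arcs n E \<longrightarrow> (j, k) \<in> Arcs n E \<longrightarrow> (k, l) \<in> Arcs n E \<longrightarrow> (l, i) \<in> Arcs n E \<longrightarrow>
      distinct [i, j, k, l] \<longrightarrow> (i, k) \<notin> Arcs n E \<longrightarrow> (j, l) \<notin> Arcs n E \<longrightarrow>
      u (i, j) + u (j, k) + u (k, l) + u (l, i) = 0)" (is "_ \<longleftrightarrow> ?R")
  proof
    assume L: "\<forall>c \<in> chordless_4_cycles n E. (\<Sum>a\<in>c. u a) = 0"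
    show ?R
    proof (intro allI impI)
      fix i j k l
      assume "(i, j) \<in> Arcs n E" "(j, k) \<in> Arcs n E" "(k, l) \<in> Arcs n E" "(l, i) \<in> Arcs n E"
        and d: "distinct [i, j, k, l]" and "(i, k) \<notin> Arcs n E" "(j, l) \<notin> Arcs n E"
      then have "{(i, j), (j, k), (k, l), (l, i)} \<in> chordless_4_cycles n E"
        unfolding chordless_4_cycles_def by blast
      with L four[OF d] show "u (i, j) + u (j, k) + u (k, l) + u (l, i) = 0"
        by metis
    qed
  next
    assume R: ?R
    show "\<forall>c \<in> chordless_4_cycles n E. (\<Sum>a\<in>c. u a) = 0"
    proof
      fix c assume "c \<in> chordless_4_cycles n E"
      then obtain i j k l where c: "c = {(i, j), (j, k), (k, l), (l, i)}"
        and arcs: "{(i, j), (j, k), (k, l), (l, i)} \<subseteq> Arcs n E"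
        and d: "distinct [i, j, k, l]" and chordless: "(i, k) \<notin> Arcs n E" "(j, l) \<notin> Arcs n E"
        unfolding chordless_4_cycles_def mem_Collect_eq by (elim exE conjE) (rule that; assumption)
      show "(\<Sum>a\<in>c. u a) = 0"
        unfolding c four[OF d] by (rule R[rule_format]) (use arcs d chordless in simp_all)
    qed
  qed
  ultimately show ?thesis
    unfolding arc_potential_def ball_Un by simp
qed

lemma arc_potential_antisym:
  assumes "arc_potential n E u" "(i, j) \<in> Arcs n E"
  shows "u (i, j) = u (j, i) + 1"
  using assms unfolding arc_potential_def bit_add_eq_1_iff by blast

lemma arc_potential_triangle:
  assumes "simple_graph n E" "arc_potential n E u"
    and "(i, j) \<in> Arcs n E" "(j, k) \<in> Arcs n E" "(k, i) \<in> Arcs n E"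
  shows "u (i, j) = u (j, k)"
  using assms(2-) unfolding arc_potential_iff[OF assms(1)] by blast

section \<open>Potentials on walks of length two\<close>

definition walk_potential :: "nat \<Rightarrow> nat set set \<Rightarrow> (nat \<times> nat \<Rightarrow> bit) \<Rightarrow> bool" where
  "walk_potential n E w \<longleftrightarrow> (\<forall>i j k. (i, j) \<in> Arcs n E \<longrightarrow> (j, k) \<in> Arcs n E \<longrightarrow>
     w (i, j) + w (j, k) + w (i, k) + w (k, i) = 1)"

text \<open>The walk \<open>i, j, i\<close> gives antisymmetry, as \<open>w (i, i)\<close> occurs
  twice. In a triangle antisymmetry evaluates \<open>w (i, k) + w (k, i)\<close> to 1. For a
  4-cycle, add the equations of \<open>i, j, k\<close> and \<open>k, l, i\<close>: the diagonal
  terms and the right-hand sides cancel.\<close>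

lemma walk_potential_imp_arc_potential:
  assumes G: "simple_graph n E" and W: "walk_potential n E w"
  shows "arc_potential n E w"
proof -
  have W': "w (i, j) + w (j, k) + w (i, k) + w (k, i) = 1"
    if "(i, j) \<in> Arcs n E" "(j, k) \<in> Arcs n E" for i j k
    using W that unfolding walk_potential_def by blast
  have anti: "w (i, j) + w (j, i) = 1" if "(i, j) \<in> Arcs n E" for i j
    using W'[OF that Arcs_swap[OF that]] by (simp add: add.assoc)
  show ?thesis
    unfolding arc_potential_iff[OF G]
  proof (intro conjI allI impI ballI)
    fix a assume "a \<in> Arcs n E"
    then show "case a of (i, j) \<Rightarrow> w (i, j) + w (j, i) = 1"
      using anti by auto
  next
    fix i j k assume "(i, j) \<in> Arcs n E" "(j, k) \<in> Arcs n E" "(k, i) \<in> Arcs n E"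
    then show "w (i, j) = w (j, k)"
      using W'[of i j k] anti[of k i] by (cases "w (i, j)"; cases "w (j, k)") (simp_all add: add.commute)
  next
    fix i j k l assume "(i, j) \<in> Arcs n E" "(j, k) \<in> Arcs n E" "(k, l) \<in> Arcs n E" "(l, i) \<in> Arcs n E"
    then show "w (i, j) + w (j, k) + w (k, l) + w (l, i) = 0"
      using W'[of i j k] W'[of k l i]
      by (cases "w (i, j)"; cases "w (j, k)"; cases "w (k, l)"; cases "w (l, i)") (simp_all add: add.commute)
  qed
qed

text \<open>
  Chords do no harm: if \<open>(i, k)\<close> is an arc, the potential is constant on the two halves of the
  closed walk by the condition on partial 3-cycles.
\<close>

lemma arc_potential_closed_walk_4:
  assumes G: "simple_graph n E" and U: "arc_potential n E u"
    and "(i, j) \<in> Arcs n E" "(j, k) \<in> Arcs n E" "(k, l) \<in> Arcs n E" "(l, i) \<in> Arcs n E"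
  shows "u (i, j) + u (j, k) + u (k, l) + u (l, i) = 0"
proof -
  note anti = arc_potential_antisym[OF U] and tri = arc_potential_triangle[OF G U]
  have ne: "i \<noteq> j" "j \<noteq> k" "k \<noteq> l" "l \<noteq> i"
    using assms Arcs_irrefl[OF G] by auto
  consider "i = k" | "j = l" | "(i, k) \<in> Arcs n E" | "(j, l) \<in> Arcs n E"
    | "distinct [i, j, k, l]" "(i, k) \<notin> Arcs n E" "(j, l) \<notin> Arcs n E"
    using ne by auto
  then show ?thesis
  proof cases
    \<comment> \<open>The walk runs back and forth along two edges at \<open>i\<close>; each
      contributes 1 by antisymmetry. The case \<open>j = l\<close> is the same at
      \<open>j\<close>.\<close>
    case 1
    then show ?thesis
      using assms anti[of i j] anti[of k l] by (simp add: ac_simps)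
  next
    case 2
    then show ?thesis
      using assms anti[of i j] anti[of j k] by (simp add: ac_simps)
  next
    case 3
    then show ?thesis
      using assms tri[of i j k] tri[of k l i] Arcs_swap by simp
  next
    case 4
    then show ?thesis
      using assms tri[of j k l] tri[of l i j] Arcs_swap by simp
  next
    case 5
    then show ?thesis
      using assms(3-) U unfolding arc_potential_iff[OF G] by blast
  qed
qed

text \<open>On a non-arc \<open>(i, k)\<close> with a common neighbour only
  \<open>w (i, k) + w (k, i)\<close> is prescribed. Any midpoint prescribes the same value: two
  midpoints together with \<open>i\<close> and \<open>k\<close> form a closed walk of length
  four.\<close>

lemma arc_potential_imp_walk_potential:
  assumes G: "simple_graph n E" and U: "arc_potential n E u"
  shows "\<exists>w. walk_potential n E w"
proof -
  note anti = arc_potential_antisym[OF U]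
  define mid where "mid i k = (SOME j. (i, j) \<in> Arcs n E \<and> (j, k) \<in> Arcs n E)" for i k
  \<comment> \<open>The whole prescribed sum is put on the increasing pair and 0 on the decreasing
    one. \<open>mid\<close> matters only where a common neighbour exists; on the diagonal
    \<open>w\<close> is 0 and occurs twice in the equation.\<close>
  define w where "w = (\<lambda>(i, k). if (i, k) \<in> Arcs n E then u (i, k)
    else if i < k then 1 + u (i, mid i k) + u (mid i k, k) else 0)"
  have "w (i, j) + w (j, k) + w (i, k) + w (k, i) = 1"
    if ij: "(i, j) \<in> Arcs n E" and jk: "(j, k) \<in> Arcs n E" for i j k
  proof -
    have mid: "(i, mid i k) \<in> Arcs n E \<and> (mid i k, k) \<in> Arcs n E"
      unfolding mid_def by (rule someI[of _ j]) (use ij jk in blast)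
    have mid': "(k, mid k i) \<in> Arcs n E \<and> (mid k i, i) \<in> Arcs n E"
      unfolding mid_def by (rule someI[of _ j]) (use ij jk Arcs_swap in blast)
    have w: "w (i, j) = u (i, j)" "w (j, k) = u (j, k)"
      using ij jk by (simp_all add: w_def)
    consider "i = k" | "(i, k) \<in> Arcs n E" | "(i, k) \<notin> Arcs n E" "i < k" | "(i, k) \<notin> Arcs n E" "k < i"
      by linarith
    then show ?thesis
    proof cases
      case 1
      then show ?thesis
        using w anti[OF ij] by (simp add: ac_simps)
    next
      case 2
      then have "u (i, j) = u (j, k)" "w (i, k) = w (k, i) + 1"
        using arc_potential_triangle[OF G U ij jk] Arcs_swap[of i k] anti[of i k]
        by (auto simp: w_def)
      then show ?thesis
        using w by (simp add: ac_simps)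
    next
      case 3
      then have "w (k, i) = 0" "w (i, k) = 1 + u (i, mid i k) + u (mid i k, k)"
        using Arcs_swap[of k i] by (auto simp: w_def)
      moreover have "u (i, j) + u (j, k) + u (k, mid i k) + u (mid i k, i) = 0"
        using arc_potential_closed_walk_4[OF G U ij jk] mid Arcs_swap by blast
      ultimately show ?thesis
        using w anti[of i "mid i k"] anti[of "mid i k" k] mid
        by (cases "u (i, j)"; cases "u (j, k)"; cases "u (k, mid i k)"; cases "u (mid i k, i)") simp_all
    next
      case 4
      then have "w (i, k) = 0" "w (k, i) = 1 + u (k, mid k i) + u (mid k i, i)"
        using Arcs_swap[of k i] by (auto simp: w_def)
      moreover have "u (i, j) + u (j, k) + u (k, mid k i) + u (mid k i, i) = 0"
        using arc_potential_closed_walk_4[OF G U ij jk] mid' by blast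
      ultimately show ?thesis
        using w
        by (cases "u (i, j)"; cases "u (j, k)"; cases "u (k, mid k i)"; cases "u (mid k i, i)") simp_all
    qed
  qed
  then show ?thesis
    unfolding walk_potential_def by blast
qed

text \<open>\<open>u\<close> marks the arcs along which the colour rises by 1 modulo 3; along all
  others it drops by 1. Around a triangle all steps have the same sign, and a closed walk of four
  steps must rise exactly twice, since its total change is 0 modulo 3.\<close>

lemma three_colorable_imp_arc_potential:
  assumes G: "simple_graph n E" and "three_colorable n E"
  shows "\<exists>u. arc_potential n E u"
proof -
  obtain c where c: "\<forall>i \<in> vertices n. c i \<in> {0, 1, 2::nat}" "\<forall>(i, j) \<in> Arcs n E. c i \<noteq> c j"
    using assms(2) by (auto simp: three_colorable_def)
  have col: "c i = 0 \<and> c j = 1 \<or> c i = 0 \<and> c j = 2 \<or> c i = 1 \<and> c j = 0 \<or>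
      c i = 1 \<and> c j = 2 \<or> c i = 2 \<and> c j = 0 \<or> c i = 2 \<and> c j = 1" if "(i, j) \<in> Arcs n E" for i j
  proof -
    have "i \<in> vertices n" "j \<in> vertices n"
      using that by (auto simp: Arcs_def)
    then have "c i \<in> {0, 1, 2}" "c j \<in> {0, 1, 2}" "c i \<noteq> c j"
      using c that by auto
    then show ?thesis
      by auto
  qed
  define u :: "nat \<times> nat \<Rightarrow> bit"
    where "u = (\<lambda>(i, j). of_bool (c i = 0 \<and> c j = 1 \<or> c i = 1 \<and> c j = 2 \<or> c i = 2 \<and> c j = 0))"
  have "arc_potential n E u"
    unfolding arc_potential_iff[OF G]
  proof (intro conjI allI impI ballI)
    fix a assume "a \<in> Arcs n E"
    then show "case a of (i, j) \<Rightarrow> u (i, j) + u (j, i) = 1"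
      using col by (cases a) (force simp: u_def)
  next
    fix i j k assume "(i, j) \<in> Arcs n E" "(j, k) \<in> Arcs n E" "(k, i) \<in> Arcs n E"
    from this[THEN col] show "u (i, j) = u (j, k)"
      by (elim disjE conjE) (simp_all add: u_def)
  next
    fix i j k l
    assume "(i, j) \<in> Arcs n E" "(j, k) \<in> Arcs n E" "(k, l) \<in> Arcs n E" "(l, i) \<in> Arcs n E"
    from this[THEN col] show "u (i, j) + u (j, k) + u (k, l) + u (l, i) = 0"
      by (elim disjE conjE) (simp_all add: u_def)
  qed
  then show ?thesis
    by blast
qed

section \<open>Certificates and linear functionals\<close>

definition linear_ext :: "((nat \<Rightarrow>\<^sub>0 nat) \<Rightarrow> bit) \<Rightarrow> f2poly \<Rightarrow> bit" where
  "linear_ext g p = (\<Sum>m\<in>Poly_Mapping.keys p. Poly_Mapping.lookup p m * g m)"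

lemma linear_ext_superset:
  assumes "finite K" "Poly_Mapping.keys p \<subseteq> K"
  shows "linear_ext g p = (\<Sum>m\<in>K. Poly_Mapping.lookup p m * g m)"
  unfolding linear_ext_def using assms
  by (intro sum.mono_neutral_left) (auto simp: in_keys_iff)

lemma linear_ext_add: "linear_ext g (p + q) = linear_ext g p + linear_ext g q"
proof -
  let ?K = "Poly_Mapping.keys p \<union> Poly_Mapping.keys q"
  have "linear_ext g r = (\<Sum>m\<in>?K. Poly_Mapping.lookup r m * g m)" if "r \<in> {p, q, p + q}" for r
    using that keys_add[of p q] by (intro linear_ext_superset) auto
  then show ?thesis
    by (simp add: lookup_add distrib_right sum.distrib)
qed

lemma linear_ext_single: "linear_ext g (Poly_Mapping.single m a) = a * g m"
  using linear_ext_superset[of "{m}" "Poly_Mapping.single m a"] by simp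

lemma linear_ext_sum: "linear_ext g (\<Sum>i\<in>I. p i) = (\<Sum>i\<in>I. linear_ext g (p i))"
  by (induction I rule: infinite_finite_induct) (simp_all add: linear_ext_add linear_ext_def[of g 0])

lemma lookup_Const_mult: "Poly_Mapping.lookup (Const a * p) m = a * Poly_Mapping.lookup p m"
  by (cases a) (simp_all add: Const_def)

lemma linear_ext_Const_mult: "linear_ext g (Const a * p) = a * linear_ext g p"
  by (cases a) (simp_all add: Const_def linear_ext_def[of g 0])

section \<open>Values of functionals on the generators\<close>

lemma X_power: "X i ^ e = Poly_Mapping.single (Poly_Mapping.single i e) 1"
proof (induction e)
  case (Suc e)
  then show ?case
    by (simp add: X_def mult_single flip: single_add)
qed simp

lemma X_mult_single:
  "X i * Poly_Mapping.single m a = Poly_Mapping.single (Poly_Mapping.single i 1 + m) a"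
  by (simp add: X_def mult_single)

lemma single_1_2: "Poly_Mapping.single i 1 + Poly_Mapping.single i 2 = Poly_Mapping.single i (3 :: nat)"
  by (simp add: numeral_eq_Suc flip: single_add)

lemma single_1_1_1:
  "Poly_Mapping.single i 1 + (Poly_Mapping.single i 1 + Poly_Mapping.single j 1) =
   Poly_Mapping.single j 1 + Poly_Mapping.single i (2 :: nat)"
  by (subst add.assoc[symmetric], subst single_add[symmetric], subst add.commute)
     (simp add: numeral_eq_Suc)

lemma vertex_poly_eq:
  "vertex_poly i = Poly_Mapping.single (Poly_Mapping.single i 3) 1 + Poly_Mapping.single 0 1"
  by (simp add: vertex_poly_def X_power)

lemma edge_poly_eq:
  "edge_poly {i, j} = Poly_Mapping.single (Poly_Mapping.single i 2) 1
    + Poly_Mapping.single (Poly_Mapping.single i 1 + Poly_Mapping.single j 1) 1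
    + Poly_Mapping.single (Poly_Mapping.single j 2) 1"
  by (simp add: edge_poly_doubleton X_power X_mult_single flip: X_power[of _ 1, simplified])
     (simp add: X_def mult_single)

lemma linear_ext_vertex_poly: "linear_ext g (vertex_poly i) = g (Poly_Mapping.single i 3) + g 0"
  by (simp only: vertex_poly_eq linear_ext_add linear_ext_single mult_1_left)

lemma linear_ext_X_vertex_poly:
  "linear_ext g (X j * vertex_poly i) =
    g (Poly_Mapping.single j 1 + Poly_Mapping.single i 3) + g (Poly_Mapping.single j 1)"
  by (simp only: vertex_poly_eq linear_ext_add linear_ext_single mult_1_left distrib_left
      X_mult_single add_0_right)

lemma linear_ext_edge_poly:
  "linear_ext g (edge_poly {i, j}) = g (Poly_Mapping.single i 2)
    + g (Poly_Mapping.single i 1 + Poly_Mapping.single j 1) + g (Poly_Mapping.single j 2)"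
  by (simp only: edge_poly_eq linear_ext_add linear_ext_single mult_1_left)

lemma linear_ext_X_edge_poly:
  "linear_ext g (X k * edge_poly {i, j}) = g (Poly_Mapping.single k 1 + Poly_Mapping.single i 2)
    + g (Poly_Mapping.single k 1 + (Poly_Mapping.single i 1 + Poly_Mapping.single j 1))
    + g (Poly_Mapping.single k 1 + Poly_Mapping.single j 2)"
  by (simp only: edge_poly_eq linear_ext_add linear_ext_single mult_1_left distrib_left X_mult_single)

section \<open>Duality between certificates and functionals\<close>

lemma certificate_functional:
  assumes "has_degree_one_certificate n E"
    and "\<And>i. i \<in> vertices n \<Longrightarrow> linear_ext g (vertex_poly i) = 0"
    and "\<And>i j. i \<in> vertices n \<Longrightarrow> j \<in> vertices n \<Longrightarrow> linear_ext g (X j * vertex_poly i) = 0"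
    and "\<And>e. e \<in> E \<Longrightarrow> linear_ext g (edge_poly e) = 0"
    and "\<And>e k. e \<in> E \<Longrightarrow> k \<in> vertices n \<Longrightarrow> linear_ext g (X k * edge_poly e) = 0"
  shows "g 0 = 0"
proof -
  obtain a a' b b' where
    "(\<Sum>i \<in> vertices n. (Const (a i) + (\<Sum>j \<in> vertices n. Const (a' i j) * X j)) * vertex_poly i)
      + (\<Sum>e \<in> E. (Const (b e) + (\<Sum>k \<in> vertices n. Const (b' e k) * X k)) * edge_poly e) = 1"
    (is "?p = 1")
    using assms(1) unfolding has_degree_one_certificate_def by blast
  then have "linear_ext g ?p = linear_ext g (Poly_Mapping.single 0 1)"
    by simp
  moreover have "linear_ext g ?p = 0"
    by (simp add: linear_ext_add linear_ext_sum distrib_right sum_distrib_right mult.assoc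
        linear_ext_Const_mult assms)
  ultimately show ?thesis
    by (simp only: linear_ext_single mult_1_left)
qed

text \<open>A combination of just the vertex polynomials and the products
  \<open>X k * edge_poly e\<close> is already of the shape of a certificate, with the other
  coefficients 0. Hence 1 lies outside their span, and the Fredholm alternative separates
  it.\<close>

lemma no_certificate_functional:
  assumes "finite E" "\<not> has_degree_one_certificate n E"
  shows "\<exists>g. g 0 = 1 \<and> (\<forall>i\<in>vertices n. linear_ext g (vertex_poly i) = 0) \<and>
    (\<forall>e\<in>E. \<forall>k\<in>vertices n. linear_ext g (X k * edge_poly e) = 0)"
proof -
  define I where "I = vertices n <+> E \<times> vertices n"
  define p where "p = case_sum vertex_poly (\<lambda>(e, k). X k * edge_poly e)"
  \<comment> \<open>Comparing coefficients on the monomials of the generators suffices, but the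
    monomial 0 must be added: it carries the coefficient of the target 1.\<close>
  define K where "K = insert 0 (\<Union>x\<in>I. Poly_Mapping.keys (p x))"
  have fin: "finite I" "finite K"
    using assms(1) by (simp_all add: I_def K_def vertices_def)
  have "\<nexists>c. \<forall>m\<in>K. (\<Sum>x\<in>I. c x * Poly_Mapping.lookup (p x) m) = Poly_Mapping.lookup (1 :: f2poly) m"
  proof
    assume "\<exists>c. \<forall>m\<in>K. (\<Sum>x\<in>I. c x * Poly_Mapping.lookup (p x) m) = Poly_Mapping.lookup (1 :: f2poly) m"
    then obtain c where c:
      "\<forall>m\<in>K. (\<Sum>x\<in>I. c x * Poly_Mapping.lookup (p x) m) = Poly_Mapping.lookup (1 :: f2poly) m" ..
    have "(\<Sum>x\<in>I. Const (c x) * p x) = 1"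
    proof (rule poly_mapping_eqI)
      fix m
      show "Poly_Mapping.lookup (\<Sum>x\<in>I. Const (c x) * p x) m = Poly_Mapping.lookup 1 m"
      proof (cases "m \<in> K")
        case True
        then show ?thesis
          using c by (simp add: lookup_sum lookup_Const_mult)
      next
        case False
        then have "Poly_Mapping.lookup (p x) m = 0" if "x \<in> I" for x
          using that by (auto simp: K_def in_keys_iff)
        moreover have "m \<noteq> 0"
          using False by (auto simp: K_def)
        ultimately show ?thesis
          by (simp add: lookup_sum lookup_Const_mult lookup_one)
      qed
    qed
    then have "(\<Sum>i\<in>vertices n. (Const (c (Inl i)) + (\<Sum>j\<in>vertices n. Const 0 * X j)) * vertex_poly i)
      + (\<Sum>e\<in>E. (Const 0 + (\<Sum>k\<in>vertices n. Const (c (Inr (e, k))) * X k)) * edge_poly e) = 1"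
      using assms(1)
      by (simp add: I_def p_def sum.Plus vertices_def Const_def[of 0] sum_distrib_right mult.assoc
          sum.cartesian_product case_prod_unfold)
    then have "has_degree_one_certificate n E"
      unfolding has_degree_one_certificate_def
      by (intro exI[of _ "\<lambda>i. c (Inl i)"] exI[of _ "\<lambda>_ _. 0"] exI[of _ "\<lambda>_. 0"]
          exI[of _ "\<lambda>e k. c (Inr (e, k))"])
    with assms(2) show False ..
  qed
  from Fredholm_alternative_bit[OF fin this] obtain g where g:
    "\<forall>x\<in>I. (\<Sum>m\<in>K. g m * Poly_Mapping.lookup (p x) m) = 0"
    "(\<Sum>m\<in>K. g m * Poly_Mapping.lookup (1 :: f2poly) m) = 1"
    by blast
  have vanish: "linear_ext g (p x) = 0" if "x \<in> I" for x
    using g(1) that fin linear_ext_superset[of K "p x" g] by (auto simp: K_def mult.commute)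
  have "linear_ext g (p (Inl i)) = 0" if "i \<in> vertices n" for i
    by (rule vanish) (use that in \<open>auto simp: I_def\<close>)
  moreover have "linear_ext g (p (Inr (e, k))) = 0" if "e \<in> E" "k \<in> vertices n" for e k
    by (rule vanish) (use that in \<open>auto simp: I_def\<close>)
  moreover have "(\<Sum>m\<in>K. g m * Poly_Mapping.lookup (1 :: f2poly) m) = g 0"
  proof -
    have "(\<Sum>m\<in>K. g m * Poly_Mapping.lookup (1 :: f2poly) m) = (\<Sum>m\<in>K. if m = 0 then g m else 0)"
      by (intro sum.cong) (auto simp: lookup_one)
    then show ?thesis
      using fin by (simp add: K_def)
  qed
  ultimately show ?thesis
    using g(2) unfolding p_def by auto
qed

text \<open>From \<open>w\<close> a functional with value 1 on the constant 1 is assembled that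
  kills every product in a certificate. Conversely, the functional given by
  \<open>no_certificate_functional\<close> is read off on the monomials
  \<open>x_i x_j^2\<close>.\<close>

lemma certificate_iff_no_walk_potential:
  assumes G: "simple_graph n E"
  shows "has_degree_one_certificate n E \<longleftrightarrow> (\<nexists>w. walk_potential n E w)"
proof (intro iffI notI)
  assume cert: "has_degree_one_certificate n E" and "\<exists>w. walk_potential n E w"
  then obtain w where W: "walk_potential n E w"
    by blast
  have W': "w (i, j) + w (j, k) + w (i, k) + w (k, i) = 1"
    if "{i, j} \<in> E" "{j, k} \<in> E" for i j k
    using W that unfolding walk_potential_def Arcs_iff[OF G] by blast
  have anti: "w (i, j) = w (j, i) + 1" if "{i, j} \<in> E" for i j
    using W'[of i j i] that by (simp add: insert_commute add.assoc bit_add_eq_1_iff)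
  \<comment> \<open>the value forced on \<open>x\<^sub>i x\<^sub>j x\<^sub>k\<close> for \<open>S = {i, j, k}\<close> by an edge \<open>{i, j}\<close>; by \<open>s_unique\<close> any edge inside \<open>S\<close> gives the same\<close>
  define s where "s S = (SOME v. \<exists>i j k. S = {i, j, k} \<and> distinct [i, j, k] \<and> {i, j} \<in> E \<and>
    v = w (k, i) + w (k, j))" for S
  have s_unique: "w (k, i) + w (k, j) = w (c, a) + w (c, b)"
    if "{i, j, k} = {a, b, c}" "distinct [i, j, k]" "distinct [a, b, c]" "{i, j} \<in> E" "{a, b} \<in> E"
    for i j k a b c
  proof -
    \<comment> \<open>The walk equation in symmetric form: the edges \<open>{x, y}\<close> and
      \<open>{y, z}\<close> force the same value on the triple.\<close>
    have rot: "w (z, x) + w (z, y) = w (x, y) + w (x, z)" if "{x, y} \<in> E" "{y, z} \<in> E" for x y z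
      using W'[OF that] anti[of y z] that
      by (cases "w (x, y)"; cases "w (z, y)"; cases "w (x, z)"; cases "w (z, x)") simp_all
    have del: "{i, j, k} - {i} = {j, k}" "{i, j, k} - {j} = {i, k}" "{i, j, k} - {k} = {i, j}"
      using that(2) by auto
    \<comment> \<open>An edge inside the triple is the triple without its third vertex, so two edges
      inside it coincide or share a vertex; in the latter case \<open>rot\<close> applies.\<close>
    have "{a, b} = {i, j, k} - {c}"
      unfolding that(1) using that(3) by auto
    moreover have "c = i \<or> c = j \<or> c = k"
      using that(1) by auto
    ultimately consider "c = i" "{a, b} = {j, k}" | "c = j" "{a, b} = {i, k}" | "c = k" "{a, b} = {i, j}"
      using del that(1) by (elim disjE) simp_all
    then show ?thesis
    proof cases
      case 1
      then have "w (c, a) + w (c, b) = w (i, j) + w (i, k)"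
        by (auto simp: doubleton_eq_iff add.commute)
      moreover have "{j, k} \<in> E"
        using 1 that by simp
      ultimately show ?thesis
        using rot[of i j k] that by simp
    next
      case 2
      then have "w (c, a) + w (c, b) = w (j, i) + w (j, k)"
        by (auto simp: doubleton_eq_iff add.commute)
      moreover have "{i, k} \<in> E"
        using 2 that by simp
      ultimately show ?thesis
        using rot[of j i k] that by (simp add: insert_commute add.commute)
    next
      case 3
      then show ?thesis
        by (auto simp: doubleton_eq_iff add.commute)
    qed
  qed
  have s: "s {i, j, k} = w (k, i) + w (k, j)" if "distinct [i, j, k]" "{i, j} \<in> E" for i j k
    unfolding s_def
  proof (rule some_equality)
    show "\<exists>i' j' k'. {i, j, k} = {i', j', k'} \<and> distinct [i', j', k'] \<and> {i', j'} \<in> E \<and>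
        w (k, i) + w (k, j) = w (k', i') + w (k', j')"
      using that by blast
  next
    fix v
    assume "\<exists>i' j' k'. {i, j, k} = {i', j', k'} \<and> distinct [i', j', k'] \<and> {i', j'} \<in> E \<and>
        v = w (k', i') + w (k', j')"
    then show "v = w (k, i) + w (k, j)"
      using s_unique that by metis
  qed
  define deg where "deg m = (\<Sum>v\<in>vertices n. Poly_Mapping.lookup m v)" for m :: "nat \<Rightarrow>\<^sub>0 nat"
  have deg_add: "deg (m + m') = deg m + deg m'" for m m'
    by (simp add: deg_def lookup_add sum.distrib)
  have deg_single: "deg (Poly_Mapping.single i d) = d" if "i \<in> vertices n" for i d
  proof -
    have "deg (Poly_Mapping.single i d) = (\<Sum>v\<in>vertices n. if v = i then d else 0)"
      unfolding deg_def by (intro sum.cong) (auto simp: lookup_single when_def)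
    then show ?thesis
      using that by (simp add: vertices_def)
  qed
  \<comment> \<open>The cube \<open>x_i^3\<close> gets the value of the constant 1, as the vertex
    polynomials demand; \<open>x_i x_j^2\<close> gets \<open>w (i, j)\<close>, a squarefree cubic
    gets \<open>s\<close>. Degrees other than 0 and 3 get 0, so \<open>edge_poly e\<close> and
    \<open>X j * vertex_poly i\<close> vanish term by term.\<close>
  define g where "g m =
    (if deg m = 0 then 1
     else if deg m \<noteq> 3 then 0
     else if \<exists>i. Poly_Mapping.lookup m i = 3 then 1
     else if \<exists>i. Poly_Mapping.lookup m i = 2
       then w (THE i. Poly_Mapping.lookup m i = 1, THE i. Poly_Mapping.lookup m i = 2)
     else s (Poly_Mapping.keys m))" for m
  have "g 0 = 1"
    by (simp add: g_def deg_def)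
  have g_deg: "g m = 0" if "deg m \<noteq> 0" "deg m \<noteq> 3" for m
    using that by (simp add: g_def)
  have g3: "g (Poly_Mapping.single i 3) = 1" if "i \<in> vertices n" for i
    using that by (auto simp: g_def deg_single lookup_single when_def)
  have g21: "g (Poly_Mapping.single i 1 + Poly_Mapping.single j 2) = w (i, j)"
    if "i \<in> vertices n" "j \<in> vertices n" "i \<noteq> j" for i j
  proof -
    let ?m = "Poly_Mapping.single i 1 + Poly_Mapping.single j (2::nat)"
    have l: "Poly_Mapping.lookup ?m v = (if v = i then 1 else if v = j then 2 else 0)" for v
      using that by (simp add: lookup_add lookup_single when_def)
    have l1: "Poly_Mapping.lookup ?m v = 1 \<longleftrightarrow> v = i" and l2: "Poly_Mapping.lookup ?m v = 2 \<longleftrightarrow> v = j"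
      and l3: "Poly_Mapping.lookup ?m v \<noteq> 3" for v
      unfolding l using that by auto
    have "deg ?m = 3"
      using that by (simp add: deg_add deg_single)
    then show ?thesis
      unfolding g_def l1 l2 using l3 by simp
  qed
  have g111: "g (Poly_Mapping.single k 1 + (Poly_Mapping.single i 1 + Poly_Mapping.single j 1)) = s {i, j, k}"
    if "i \<in> vertices n" "j \<in> vertices n" "k \<in> vertices n" "distinct [i, j, k]" for i j k
  proof -
    let ?m = "Poly_Mapping.single k 1 + (Poly_Mapping.single i 1 + Poly_Mapping.single j (1::nat))"
    have l: "Poly_Mapping.lookup ?m v = (if v \<in> {i, j, k} then 1 else 0)" for v
      using that by (auto simp: lookup_add lookup_single when_def)
    then have l23: "Poly_Mapping.lookup ?m v \<noteq> 2" "Poly_Mapping.lookup ?m v \<noteq> 3" for v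
      by simp_all
    have "Poly_Mapping.keys ?m = {i, j, k}"
      by (rule set_eqI) (unfold in_keys_iff l, simp)
    moreover have "deg ?m = 3"
      using that by (simp add: deg_add deg_single)
    ultimately show ?thesis
      unfolding g_def using l23 by simp
  qed
  \<comment> \<open>Multiplying by an end of the edge gives
    \<open>x_i^3 + x_j x_i^2 + x_i x_j^2\<close>, whose value \<open>1 + w (j, i) + w (i, j)\<close>
    is 0 by antisymmetry.\<close>
  have g_end: "linear_ext g (X i * edge_poly {i, j}) = 0" if "{i, j} \<in> E" for i j
  proof -
    note ends = edge_ends[OF G that]
    have "linear_ext g (X i * edge_poly {i, j}) = g (Poly_Mapping.single i 3)
      + g (Poly_Mapping.single j 1 + Poly_Mapping.single i 2)
      + g (Poly_Mapping.single i 1 + Poly_Mapping.single j 2)"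
      unfolding linear_ext_X_edge_poly single_1_2 single_1_1_1 ..
    then show ?thesis
      using ends g3 g21 anti[OF that] by simp
  qed
  have "g 0 = 0"
  proof (rule certificate_functional[OF cert])
    show "linear_ext g (vertex_poly i) = 0" if "i \<in> vertices n" for i
      using that g3 \<open>g 0 = 1\<close> by (simp add: linear_ext_vertex_poly)
    show "linear_ext g (X j * vertex_poly i) = 0" if "i \<in> vertices n" "j \<in> vertices n" for i j
      using that by (simp add: linear_ext_X_vertex_poly g_deg deg_add deg_single)
  next
    fix e assume "e \<in> E"
    then obtain i j where e: "e = {i, j}"
      using edgeE[OF G] by blast
    note ends = edge_ends[OF G \<open>e \<in> E\<close>[unfolded e]]
    show "linear_ext g (edge_poly e) = 0"
      unfolding e linear_ext_edge_poly using ends by (simp add: g_deg deg_add deg_single)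
    fix k assume k: "k \<in> vertices n"
    consider "k = i" | "k = j" | "distinct [i, j, k]"
      using ends by auto
    then show "linear_ext g (X k * edge_poly e) = 0"
    proof cases
      case 1
      with g_end \<open>e \<in> E\<close> show ?thesis
        by (simp add: e)
    next
      case 2
      with g_end[of j i] \<open>e \<in> E\<close> show ?thesis
        by (simp add: e insert_commute)
    next
      case 3
      then show ?thesis
        unfolding e linear_ext_X_edge_poly
        using ends k g21 g111[of i j k] s[of i j k] \<open>e \<in> E\<close> by (simp add: e)
    qed
  qed
  with \<open>g 0 = 1\<close> show False
    by simp
next
  assume no_walk: "\<nexists>w. walk_potential n E w"
  show "has_degree_one_certificate n E"
  proof (rule ccontr)
    assume "\<not> has_degree_one_certificate n E"
    from no_certificate_functional[OF finite_edges[OF G] this] obtain g where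
      g: "g 0 = 1" "\<forall>i\<in>vertices n. linear_ext g (vertex_poly i) = 0"
      "\<forall>e\<in>E. \<forall>k\<in>vertices n. linear_ext g (X k * edge_poly e) = 0"
      by blast
    define w where "w = (\<lambda>(i, j). g (Poly_Mapping.single i 1 + Poly_Mapping.single j 2))"
    have tri: "w (k, i) + w (k, j) =
        g (Poly_Mapping.single k 1 + (Poly_Mapping.single i 1 + Poly_Mapping.single j 1))"
      if "{i, j} \<in> E" "k \<in> vertices n" for i j k
      using g(3)[rule_format, OF that]
      unfolding linear_ext_X_edge_poly w_def
      by (cases "g (Poly_Mapping.single k 1 + Poly_Mapping.single i 2)";
          cases "g (Poly_Mapping.single k 1 + Poly_Mapping.single j 2)") simp_all
    \<comment> \<open>Multiplying the edge polynomial by its end \<open>x_i\<close> produces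
      \<open>x_i^3\<close>, whose value \<open>w (i, i)\<close> is forced to 1 by the vertex
      polynomial.\<close>
    have anti: "w (j, i) = w (i, j) + 1" if "{i, j} \<in> E" for i j
    proof -
      note ends = edge_ends[OF G that]
      have "w (i, i) = 1"
        using g ends by (simp add: linear_ext_vertex_poly w_def single_1_2[simplified])
      moreover have "w (j, i) = g (Poly_Mapping.single i 1 + (Poly_Mapping.single i 1 + Poly_Mapping.single j 1))"
        unfolding w_def single_1_1_1 by simp
      ultimately show ?thesis
        using tri[OF that ends(2)] by (simp add: add.commute)
    qed
    have "walk_potential n E w"
      unfolding walk_potential_def Arcs_iff[OF G]
    proof (intro allI impI)
      fix i j k assume e: "{i, j} \<in> E" "{j, k} \<in> E"
      \<comment> \<open>The monomial \<open>x_i x_j x_k\<close> occurs both in \<open>x_k\<close>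
        times the edge \<open>{i, j}\<close> and in \<open>x_i\<close> times the edge
        \<open>{j, k}\<close>; equating its two values eliminates it.\<close>
      have "w (k, i) + w (k, j) = w (i, j) + w (i, k)"
        using tri[OF e(1), of k] tri[OF e(2), of i] edge_ends[OF G e(1)] edge_ends[OF G e(2)]
        by (simp add: ac_simps)
      then show "w (i, j) + w (j, k) + w (i, k) + w (k, i) = 1"
        using anti[OF e(2)]
        by (cases "w (i, j)"; cases "w (k, j)"; cases "w (i, k)"; cases "w (k, i)") simp_all
    qed
    with no_walk show False
      by blast
  qed
qed

section \<open>Weakest preconditions for the machine\<close>

declare One_nat_def [simp del]

text \<open>The postcondition also receives the running time, so a single statement covers halting,
  result and cost.\<close>

definition wp :: "prog \<Rightarrow> (nat \<Rightarrow> config \<Rightarrow> bool) \<Rightarrow> config \<Rightarrow> bool" where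
  "wp p Q s \<longleftrightarrow> (\<exists>t s'. runs p s t s' \<and> Q t s')"

lemma wp_mono:
  assumes "wp p Q s" "\<And>t r m. Q t (r, m) \<Longrightarrow> Q' t (r, m)"
  shows "wp p Q' s"
  using assms unfolding wp_def by (metis surj_pair)

lemma wp_instr [simp]:
  "wp (Set d c) Q (r, m) \<longleftrightarrow> Q 1 (r(d := c), m)"
  "wp (Add d s t) Q (r, m) \<longleftrightarrow> Q 1 (r(d := r s + r t), m)"
  "wp (Sub d s t) Q (r, m) \<longleftrightarrow> Q 1 (r(d := r s - r t), m)"
  "wp (Load d s) Q (r, m) \<longleftrightarrow> Q 1 (r(d := m (r s)), m)"
  "wp (Store d s) Q (r, m) \<longleftrightarrow> Q 1 (r, m(r d := r s))"
  unfolding wp_def by (auto intro: runs.intros elim: runs.cases)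

lemma wp_Seq [simp]: "wp (Seq p q) Q = wp p (\<lambda>t. wp q (\<lambda>t'. Q (t + t')))"
proof
  fix s
  have "runs (Seq p q) s u s'' \<longleftrightarrow> (\<exists>t t' s'. runs p s t s' \<and> runs q s' t' s'' \<and> u = t + t')" for u s''
  proof
    assume "runs (Seq p q) s u s''"
    then show "\<exists>t t' s'. runs p s t s' \<and> runs q s' t' s'' \<and> u = t + t'"
      by (cases rule: runs.cases) blast
  qed (blast intro: runs.Seq)
  then show "wp (Seq p q) Q s = wp p (\<lambda>t. wp q (\<lambda>t'. Q (t + t'))) s"
    unfolding wp_def by (auto; blast)
qed

lemma wp_IfNZ [simp]:
  "wp (IfNZ x p q) Q (r, m) \<longleftrightarrow>
    (if r x \<noteq> 0 then wp p (\<lambda>t. Q (1 + t)) (r, m) else wp q (\<lambda>t. Q (1 + t)) (r, m))"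
proof -
  have "runs (IfNZ x p q) (r, m) u s' \<longleftrightarrow>
      (\<exists>t. (if r x \<noteq> 0 then runs p (r, m) t s' else runs q (r, m) t s') \<and> u = 1 + t)" for u s'
    by (cases "r x = 0") (auto intro: runs.intros elim: runs.cases)
  then show ?thesis
    unfolding wp_def by auto
qed

text \<open>Register \<open>x\<close> counts down from \<open>N\<close>. Each of the
  \<open>N\<close> rounds costs one test and at most \<open>T\<close>; the final failing test costs
  one more.\<close>

lemma wp_WhileNZ_countdown:
  assumes "P N r m"
    and counter: "\<And>k r m. P k r m \<Longrightarrow> r x = k"
    and body: "\<And>k r m. k < N \<Longrightarrow> P (Suc k) r m \<Longrightarrow>
      wp body (\<lambda>t (r', m'). t \<le> T \<and> P k r' m') (r, m)"
  shows "wp (WhileNZ x body) (\<lambda>t (r', m'). t \<le> (T + 1) * N + 1 \<and> P 0 r' m') (r, m)"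
proof -
  have "wp (WhileNZ x body) (\<lambda>t (r', m'). t \<le> (T + 1) * k + 1 \<and> P 0 r' m') (r, m)"
    if "k \<le> N" "P k r m" for k
    using that
  proof (induction k arbitrary: r m)
    case 0
    then have "r x = 0"
      using counter by blast
    then have "runs (WhileNZ x body) (r, m) 1 (r, m)"
      by (intro runs.WhileFalse) simp
    then show ?case
      using 0 unfolding wp_def by auto
  next
    case (Suc k)
    from body[of k r m] Suc.prems obtain t1 r1 m1 where
      1: "runs body (r, m) t1 (r1, m1)" "t1 \<le> T" "P k r1 m1"
      unfolding wp_def by auto
    from Suc.IH[of r1 m1] 1(3) Suc.prems(1) obtain t2 r2 m2 where
      2: "runs (WhileNZ x body) (r1, m1) t2 (r2, m2)" "t2 \<le> (T + 1) * k + 1" "P 0 r2 m2"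
      unfolding wp_def by auto
    have "runs (WhileNZ x body) (r, m) (1 + t1 + t2) (r2, m2)"
      using counter[OF Suc.prems(2)] 1(1) 2(1) by (intro runs.WhileTrue) auto
    moreover have "1 + t1 + t2 \<le> (T + 1) * Suc k + 1"
      using 1(2) 2(2) by simp
    ultimately show ?case
      using 2(3) unfolding wp_def by blast
  qed
  then show ?thesis
    using assms(1) by blast
qed

text \<open>The machine has no skip instruction; clearing the scratch register 21 takes its place,
  here and in empty branches.\<close>

fun seq :: "prog list \<Rightarrow> prog" where
  "seq [] = Set 21 0"
| "seq [p] = p"
| "seq (p # ps) = Seq p (seq ps)"

text \<open>With truncated subtraction this is the distance of \<open>x\<close> and
  \<open>y\<close>: exclusive or on bits, and congruent to \<open>x + y\<close> modulo 2 in
  general.\<close>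

definition bxor :: "nat \<Rightarrow> nat \<Rightarrow> nat" where
  "bxor x y = (x - y) + (y - x)"

lemma of_nat_bxor: "of_nat (bxor x y) = (of_nat x + of_nat y :: bit)"
  by (cases "x \<le> y") (simp_all add: bxor_def of_nat_diff add.commute)

lemma bxor_le_1: "x \<le> 1 \<Longrightarrow> y \<le> 1 \<Longrightarrow> bxor x y \<le> 1"
  by (simp add: bxor_def)

section \<open>Cutting a spanned subspace by a linear equation\<close>

text \<open>Coordinates from \<open>N\<close> on are unconstrained, so the unit rows span the whole
  type. There are always as many rows as columns; a deleted row becomes 0.\<close>

definition row_span :: "nat \<Rightarrow> (nat \<Rightarrow> nat \<Rightarrow> bit) \<Rightarrow> (nat \<Rightarrow> bit) set" where
  "row_span N b = {x. \<exists>c. \<forall>a<N. x a = (\<Sum>q<N. c q * b q a)}"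

lemma row_spanI: "(\<And>a. a < N \<Longrightarrow> x a = (\<Sum>q<N. c q * b q a)) \<Longrightarrow> x \<in> row_span N b"
  unfolding row_span_def by blast

lemma row_span_cong:
  assumes "\<And>q a. q < N \<Longrightarrow> a < N \<Longrightarrow> b q a = b' q a"
  shows "row_span N b = row_span N b'"
  unfolding row_span_def using assms by auto

text \<open>In characteristic 2 the old term at \<open>q\<close> is removed by adding it once
  more.\<close>

lemma sum_update_row:
  fixes c d :: "nat \<Rightarrow> bit" and b :: "nat \<Rightarrow> nat \<Rightarrow> bit"
  assumes "q < N" "\<And>k. k \<noteq> q \<Longrightarrow> b' k = b k" "\<And>k. k \<noteq> q \<Longrightarrow> d k = c k"
  shows "(\<Sum>k<N. d k * b' k a) = (\<Sum>k<N. c k * b k a) + c q * b q a + d q * b' q a"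
proof -
  have "(\<Sum>k<N. d k * b' k a) = d q * b' q a + (\<Sum>k\<in>{..<N} - {q}. c k * b k a)"
    using assms by (subst sum.remove[of _ q]) auto
  moreover have "(\<Sum>k<N. c k * b k a) = c q * b q a + (\<Sum>k\<in>{..<N} - {q}. c k * b k a)"
    using assms by (subst sum.remove[of _ q]) auto
  ultimately show ?thesis
    by (simp add: ac_simps)
qed

lemma row_span_add_row_subset:
  assumes "p < N" "q < N" "p \<noteq> q"
  shows "row_span N (b(q := \<lambda>a. b q a + b p a)) \<subseteq> row_span N b"
proof
  let ?b = "b(q := \<lambda>a. b q a + b p a)"
  fix x assume "x \<in> row_span N ?b"
  then obtain c where c: "\<forall>a<N. x a = (\<Sum>k<N. c k * ?b k a)"
    by (auto simp: row_span_def)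
  \<comment> \<open>A multiple of the new row \<open>q\<close> is the same multiple of the old rows
    \<open>q\<close> and \<open>p\<close>.\<close>
  let ?d = "c(p := c p + c q)"
  have "(\<Sum>k<N. ?d k * b k a) = (\<Sum>k<N. c k * ?b k a)" for a
    using assms sum_update_row[of q N ?b b c c a] sum_update_row[of p N b b ?d c a]
    by (simp add: ac_simps distrib_left distrib_right)
  then show "x \<in> row_span N b"
    using c by (intro row_spanI[of N x ?d]) simp
qed

text \<open>Adding row \<open>p\<close> to row \<open>q\<close> is an involution, so one inclusion
  gives the other.\<close>

lemma row_span_add_row:
  assumes "p < N" "q < N" "p \<noteq> q"
  shows "row_span N (b(q := \<lambda>a. b q a + b p a)) = row_span N b"
proof
  let ?b = "b(q := \<lambda>a. b q a + b p a)"
  have "?b(q := \<lambda>a. ?b q a + ?b p a) = b"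
    using assms(3) by (auto simp: fun_eq_iff add.assoc)
  then show "row_span N b \<subseteq> row_span N ?b"
    using row_span_add_row_subset[OF assms, of ?b] by simp
qed (rule row_span_add_row_subset[OF assms])

text \<open>On a combination of the rows \<open>f\<close> takes the coefficient of row
  \<open>p\<close> as its value, so its kernel consists of the combinations without that row. The
  five columns may coincide: for a walk \<open>i, j, i\<close> those of \<open>(i, k)\<close> and
  \<open>(k, i)\<close> do.\<close>

lemma row_span_cut:
  assumes "p < N" "q1 < N" "q2 < N" "q3 < N" "q4 < N" "q5 < N"
  defines "f \<equiv> \<lambda>x :: nat \<Rightarrow> bit. x q1 + x q2 + x q3 + x q4 + x q5"
  assumes "f (b p) = 1" "\<And>q. q < N \<Longrightarrow> q \<noteq> p \<Longrightarrow> f (b q) = 0"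
  shows "row_span N (b(p := \<lambda>a. 0)) = {x \<in> row_span N b. f x = 0}"
proof -
  let ?b = "b(p := \<lambda>a. 0)"
  have cut: "(\<Sum>k<N. c k * ?b k a) = (\<Sum>k<N. c k * b k a) + c p * b p a" for c a
    using assms(1) sum_update_row[of p N ?b b c c a] by simp
  have f_comb: "f x = (\<Sum>k<N. c k * f (b k))" if "\<forall>a<N. x a = (\<Sum>k<N. c k * b k a)" for x c
    using that assms(2-6) by (simp add: f_def distrib_left sum.distrib)
  have f_p: "(\<Sum>k<N. c k * f (b k)) = c p" for c
  proof -
    have "(\<Sum>k<N. c k * f (b k)) = (\<Sum>k<N. if k = p then c p else 0)"
      using assms(8,9) by (intro sum.cong) auto
    then show ?thesis
      using assms(1) by simp
  qed
  show ?thesis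
  proof (intro set_eqI iffI)
    fix x assume "x \<in> row_span N ?b"
    then obtain c where c: "\<forall>a<N. x a = (\<Sum>k<N. c k * ?b k a)"
      by (auto simp: row_span_def)
    let ?d = "c(p := 0)"
    have "\<forall>a<N. x a = (\<Sum>k<N. ?d k * b k a)"
      using c cut sum_update_row[of p N b b ?d c] assms(1) by simp
    then show "x \<in> {x \<in> row_span N b. f x = 0}"
      using f_comb[of x ?d] f_p[of ?d] row_spanI[of N x ?d b] by simp
  next
    fix x assume "x \<in> {x \<in> row_span N b. f x = 0}"
    then obtain c where c: "\<forall>a<N. x a = (\<Sum>k<N. c k * b k a)" and "f x = 0"
      by (auto simp: row_span_def)
    then have "c p = 0"
      using f_comb[of x c] f_p[of c] by simp
    then show "x \<in> row_span N ?b"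
      using c cut[of c] by (intro row_spanI[of N x c]) simp
  qed
qed

lemma row_span_uncut:
  assumes "q1 < N" "q2 < N" "q3 < N" "q4 < N" "q5 < N"
  defines "f \<equiv> \<lambda>x :: nat \<Rightarrow> bit. x q1 + x q2 + x q3 + x q4 + x q5"
  assumes "\<And>q. q < N \<Longrightarrow> f (b q) = 0"
  shows "row_span N b = {x \<in> row_span N b. f x = 0}"
proof -
  have "f x = 0" if x: "x \<in> row_span N b" for x
  proof -
    obtain c where c: "\<forall>a<N. x a = (\<Sum>k<N. c k * b k a)"
      using x unfolding row_span_def by blast
    then have "f x = (\<Sum>k<N. c k * f (b k))"
      using assms(1-5) by (simp add: f_def distrib_left sum.distrib)
    then show ?thesis
      using assms(7) by simp
  qed
  then show ?thesis
    by blast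
qed

lemma row_span_unit_rows: "row_span N (\<lambda>q a. of_bool (a = q)) = UNIV"
proof -
  have "x \<in> row_span N (\<lambda>q a. of_bool (a = q))" for x
    unfolding row_span_def by (auto intro!: exI[of _ x])
  then show ?thesis
    by blast
qed

lemma row_span_contains_row:
  assumes "q < N"
  shows "b q \<in> row_span N b"
  unfolding row_span_def using assms by (auto intro!: exI[of _ "\<lambda>k. of_bool (k = q)"])

section \<open>The decision program\<close>

text \<open>
  Register use. 0: \<open>n\<close>; 1: the constant 1; 2: \<open>M = n * n\<close>; 3: \<open>N = M + 1\<close>; 4: the constant 0;
  5: \<open>M + N * N\<close>, the end of the matrix; 6, 8, 10: loop counters \<open>i\<close>, \<open>j\<close>, \<open>k\<close>; 7, 9, 11: their
  multiples by \<open>n\<close>; 12 to 15: the columns occurring in the current equation; 16: row counter;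
  17: address of the current row; 18: address of the pivot row, 0 if there is none yet; 19: column
  counter; 20: value of the equation on the current row; from 21 on: scratch.

  Memory: the adjacency matrix below \<open>M\<close>, then \<open>N\<close> rows of \<open>N\<close> bits. Column \<open>i * n + j\<close> is the
  unknown \<open>w (i + 1, j + 1)\<close>; column \<open>M\<close> is the homogenising coordinate.
\<close>

definition xor_row :: prog where
  "xor_row = seq [Add 19 3 4, WhileNZ 19 (seq [Sub 19 19 1, Add 21 17 19, Add 22 18 19,
     Load 23 21, Load 24 22, Sub 25 23 24, Sub 26 24 23, Add 23 25 26, Store 21 23])]"

text \<open>The two rows coincide or do not overlap, so every cell is read before it is overwritten.
  For \<open>R = P\<close> the effect is to clear the row.\<close>

lemma wp_xor_row:
  assumes r: "r 1 = 1" "r 3 = N" "r 4 = 0" "r 17 = R" "r 18 = P"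
    and disj: "R = P \<or> R + N \<le> P \<or> P + N \<le> R"
  shows "wp xor_row (\<lambda>t (r', m'). t \<le> 10 * N + 2 \<and> (\<forall>x<19. r' x = r x) \<and>
      m' = (\<lambda>a. if R \<le> a \<and> a < R + N then bxor (m a) (m (P + (a - R))) else m a)) (r, m)"
proof -
  define Inv where "Inv k r' m' \<longleftrightarrow> r' 19 = k \<and> (\<forall>x<19. r' x = r x) \<and>
      m' = (\<lambda>a. if R + k \<le> a \<and> a < R + N then bxor (m a) (m (P + (a - R))) else m a)"
    for k and r' m' :: "nat \<Rightarrow> nat"
  have step: "wp (seq [Sub 19 19 1, Add 21 17 19, Add 22 18 19,
      Load 23 21, Load 24 22, Sub 25 23 24, Sub 26 24 23, Add 23 25 26, Store 21 23])
      (\<lambda>t (r', m'). t \<le> 9 \<and> Inv k r' m') (r', m')"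
    if k: "k < N" and I: "Inv (Suc k) r' m'" for k r' m'
  proof -
    have r': "r' 1 = 1" "r' 17 = R" "r' 18 = P" "r' 19 = Suc k" and frame: "\<forall>x<19. r' x = r x"
      using I r by (auto simp: Inv_def)
    have "m' (R + k) = m (R + k)" "m' (P + k) = m (P + k)"
      using I k disj by (auto simp: Inv_def)
    then have "(m'(R + k := m' (R + k) - m' (P + k) + (m' (P + k) - m' (R + k)))) a =
        (if R + k \<le> a \<and> a < R + N then bxor (m a) (m (P + (a - R))) else m a)" for a
      using I k by (auto simp: Inv_def bxor_def)
    then have "m'(R + k := m' (R + k) - m' (P + k) + (m' (P + k) - m' (R + k))) =
        (\<lambda>a. if R + k \<le> a \<and> a < R + N then bxor (m a) (m (P + (a - R))) else m a)"
      by (rule ext)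
    then show ?thesis
      using frame by (simp add: Inv_def r')
  qed
  have init: "Inv N (r(19 := N)) m"
    by (auto simp: Inv_def)
  have "wp (WhileNZ 19 (seq [Sub 19 19 1, Add 21 17 19, Add 22 18 19,
      Load 23 21, Load 24 22, Sub 25 23 24, Sub 26 24 23, Add 23 25 26, Store 21 23]))
      (\<lambda>t (r', m'). t \<le> (9 + 1) * N + 1 \<and> Inv 0 r' m') (r(19 := N), m)"
    by (rule wp_WhileNZ_countdown[where P = Inv, OF init _ step]) (auto simp: Inv_def)
  then show ?thesis
    unfolding xor_row_def by (simp add: r) (erule wp_mono, auto simp: Inv_def)
qed

definition xor_cell :: "nat \<Rightarrow> prog" where
  "xor_cell c = seq [Add 21 17 c, Load 21 21, Sub 22 20 21, Sub 20 21 20, Add 20 20 22]"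

lemma wp_xor_cell:
  assumes "\<And>r'. \<forall>x<20. r' x = r x \<Longrightarrow> r' 20 = bxor (r 20) (m (r 17 + r c)) \<Longrightarrow> Q 5 (r', m)"
  shows "wp (xor_cell c) Q (r, m)"
  unfolding xor_cell_def by (simp, rule assms) (simp_all add: bxor_def)

definition eval_row :: prog where
  "eval_row = seq [Set 20 0, xor_cell 12, xor_cell 13, xor_cell 14, xor_cell 15, xor_cell 2]"

text \<open>One assignment and five cells at five instructions each make 26. As all cells are bits,
  the accumulator stays a bit, and it is nonzero exactly when the row violates the equation.\<close>

lemma wp_eval_row:
  assumes le: "\<And>a. m a \<le> 1"
  shows "wp eval_row (\<lambda>t (r', m'). t = 26 \<and> m' = m \<and> (\<forall>x<20. r' x = r x) \<and> r' 20 \<le> 1 \<and>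
    of_nat (r' 20) = (of_nat (m (r 17 + r 12)) + of_nat (m (r 17 + r 13)) + of_nat (m (r 17 + r 14))
      + of_nat (m (r 17 + r 15)) + of_nat (m (r 17 + r 2)) :: bit)) (r, m)"
  unfolding eval_row_def seq.simps wp_Seq wp_instr
  apply (rule wp_xor_cell)+
  using le by (simp add: of_nat_bxor bxor_le_1)

section \<open>Imposing one equation by pivoting\<close>

definition rows :: "nat \<Rightarrow> nat \<Rightarrow> (nat \<Rightarrow> nat) \<Rightarrow> nat \<Rightarrow> nat \<Rightarrow> bit" where
  "rows M N m q a = of_nat (m (M + q * N + a))"

lemma rows_disjoint:
  assumes "p \<noteq> q"
  shows "M + q * N + N \<le> M + p * N \<or> M + p * N + N \<le> M + (q :: nat) * N"
proof -
  have "Suc q * N \<le> p * N \<or> Suc p * N \<le> q * N"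
    using assms by (metis Suc_leI linorder_neqE_nat mult_le_mono1)
  then show ?thesis
    by auto
qed

lemma rows_xor_row:
  assumes "a < N" "\<And>a. m' a = (if M + q * N \<le> a \<and> a < M + q * N + N
      then bxor (m a) (m (M + p * N + (a - (M + q * N)))) else m a)"
  shows "rows M N m' k a = (if k = q then rows M N m q a + rows M N m p a else rows M N m k a)"
proof (cases "k = q")
  case True
  then show ?thesis
    using assms(1) unfolding rows_def assms(2) by (simp add: of_nat_bxor)
next
  case False
  then show ?thesis
    using assms(1) rows_disjoint[of k q M N] unfolding rows_def assms(2) by auto
qed

text \<open>Rows are scanned from the last to the first: \<open>pass\<close> starts registers 16 and
  17 at the row count and at the end of the matrix, and each step decreases them before use.\<close>

definition row_step :: prog where
  "row_step = seq [Sub 16 16 1, Sub 17 17 3, eval_row,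
     IfNZ 20 (IfNZ 18 xor_row (Add 18 17 4)) (Set 21 0)]"

text \<open>
  The first row on which the equation takes the value 1 becomes the pivot and is added to every later
  such row, which does not change the span. Afterwards only the pivot violates the equation; adding it
  to itself removes it.
\<close>

definition pass :: prog where
  "pass = seq [Add 16 3 4, Add 17 5 4, Set 18 0, WhileNZ 16 row_step,
     IfNZ 18 (seq [Add 17 18 4, xor_row]) (Set 21 0)]"

definition bounded_mem :: "(nat \<Rightarrow> nat) \<Rightarrow> nat \<Rightarrow> (nat \<Rightarrow> nat) \<Rightarrow> bool" where
  "bounded_mem m0 M m \<longleftrightarrow> (\<forall>a. m a \<le> 1) \<and> (\<forall>a<M. m a = m0 a)"

lemma bounded_mem_xor:
  assumes "bounded_mem m0 M m"
    and "\<And>a. m' a = (if M + q \<le> a \<and> a < M + q + N then bxor (m a) (m (g a)) else m a)"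
  shows "bounded_mem m0 M m'"
  using assms unfolding bounded_mem_def by (simp add: bxor_le_1)

lemma wp_pass:
  fixes r m m0 :: "nat \<Rightarrow> nat"
  assumes r: "r 1 = 1" "r 2 = M" "r 3 = N" "r 4 = 0" "r 5 = M + N * N"
    and M: "0 < M" "M < N" and cols: "r 12 < N" "r 13 < N" "r 14 < N" "r 15 < N"
    and mem: "bounded_mem m0 M m"
  defines "f \<equiv> \<lambda>x :: nat \<Rightarrow> bit. x (r 12) + x (r 13) + x (r 14) + x (r 15) + x M"
  shows "wp pass (\<lambda>t (r', m'). t \<le> (10 * N + 40) * N + 10 * N + 10 \<and> (\<forall>x<16. r' x = r x) \<and>
    bounded_mem m0 M m' \<and>
    row_span N (rows M N m') = {x \<in> row_span N (rows M N m). f x = 0}) (r, m)"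
proof -
  define S where "S = row_span N (rows M N m)"
  \<comment> \<open>Register 18 is both flag and address. This is unambiguous because row addresses
    are at least \<open>M\<close>, which is positive.\<close>
  define scanned where "scanned k p m' \<longleftrightarrow>
    (p = 0 \<and> (\<forall>q<N. k \<le> q \<longrightarrow> f (rows M N m' q) = 0)) \<or>
    (\<exists>q0<N. k \<le> q0 \<and> p = M + q0 * N \<and> f (rows M N m' q0) = 1 \<and>
      (\<forall>q<N. k \<le> q \<and> q \<noteq> q0 \<longrightarrow> f (rows M N m' q) = 0))" for k p m'
  define Inv where "Inv k r' m' \<longleftrightarrow> k \<le> N \<and> r' 16 = k \<and> r' 17 = M + k * N \<and> (\<forall>x<16. r' x = r x) \<and>
      bounded_mem m0 M m' \<and> row_span N (rows M N m') = S \<and> scanned k (r' 18) m'"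
    for k and r' m' :: "nat \<Rightarrow> nat"
  have step: "wp row_step (\<lambda>t (r', m'). t \<le> 10 * N + 39 \<and> Inv k r' m') (r', m')"
    if k: "k < N" and I: "Inv (Suc k) r' m'" for k r' m'
  proof -
    have r': "r' 1 = 1" "r' 2 = M" "r' 3 = N" "r' 4 = 0" "r' 16 = Suc k" "r' 17 = M + Suc k * N"
      "r' 12 = r 12" "r' 13 = r 13" "r' 14 = r 14" "r' 15 = r 15"
      and frame: "\<forall>x<16. r' x = r x" and bm: "bounded_mem m0 M m'"
      and span: "row_span N (rows M N m') = S" and dn: "scanned (Suc k) (r' 18) m'"
      using I r by (auto simp: Inv_def)
    have le_iff: "k \<le> q \<longleftrightarrow> q = k \<or> Suc k \<le> q" for q
      by auto
    define r1 where "r1 = r'(16 := k, 17 := M + k * N)"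
    have "wp eval_row (\<lambda>t (r2, m2). t = 26 \<and> m2 = m' \<and> (\<forall>x<20. r2 x = r1 x) \<and> r2 20 \<le> 1 \<and>
        of_nat (r2 20) = f (rows M N m' k)) (r1, m')"
      by (rule wp_mono[OF wp_eval_row])
        (use bm in \<open>auto simp: bounded_mem_def r1_def f_def rows_def r' ac_simps\<close>)
    then have "wp eval_row (\<lambda>t. wp (IfNZ 20 (IfNZ 18 xor_row (Add 18 17 4)) (Set 21 0))
        (\<lambda>t' (r3, m3). 2 + t + t' \<le> 10 * N + 39 \<and> Inv k r3 m3)) (r1, m')"
    proof (rule wp_mono)
      fix t :: nat and r2 m2
      assume "case (r2, m2) of (r2, m2) \<Rightarrow> t = 26 \<and> m2 = m' \<and> (\<forall>x<20. r2 x = r1 x) \<and> r2 20 \<le> 1 \<and>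
        of_nat (r2 20) = f (rows M N m' k)"
      then have t: "t = 26" and m2: "m2 = m'" and frame2: "\<forall>x<20. r2 x = r1 x"
        and bit: "r2 20 \<le> 1" "of_nat (r2 20) = f (rows M N m' k)"
        by auto
      have r2: "r2 1 = 1" "r2 3 = N" "r2 4 = 0" "r2 16 = k" "r2 17 = M + k * N" "r2 18 = r' 18"
        and frame3: "\<forall>x<16. r2 x = r x"
        using frame2 frame r' by (auto simp: r1_def)
      show "wp (IfNZ 20 (IfNZ 18 xor_row (Add 18 17 4)) (Set 21 0))
        (\<lambda>t' (r3, m3). 2 + t + t' \<le> 10 * N + 39 \<and> Inv k r3 m3) (r2, m2)"
      proof (cases "r2 20 = 0")
        case True
        then have fk: "f (rows M N m' k) = 0"
          using bit by simp
        then have "scanned k (r' 18) m'"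
          using dn unfolding scanned_def le_iff by (elim disjE) auto
        then have "Inv k (r2(21 := 0)) m2"
          using k frame3 bm span by (simp add: Inv_def r2 m2)
        then show ?thesis
          using True by (simp add: t)
      next
        case False
        then have F: "r2 20 = 1"
          using bit by simp
        then have fk: "f (rows M N m' k) = 1"
          using bit by simp
        show ?thesis
        proof (cases "r' 18 = 0")
          case True
          then have "\<forall>q<N. Suc k \<le> q \<longrightarrow> f (rows M N m' q) = 0"
            using dn M unfolding scanned_def by auto
          then have "scanned k (M + k * N) m'"
            using fk k unfolding scanned_def le_iff by (intro disjI2 exI[of _ k]) auto
          then have "Inv k (r2(18 := M + k * N)) m2"
            using k frame3 bm span by (simp add: Inv_def r2 m2)
          then show ?thesis
            using True F by (simp add: t r2)
        next
          case False
          obtain p where p: "p < N" "Suc k \<le> p" "r' 18 = M + p * N" "f (rows M N m' p) = 1"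
            and others: "\<forall>q<N. Suc k \<le> q \<and> q \<noteq> p \<longrightarrow> f (rows M N m' q) = 0"
            using dn False unfolding scanned_def by (elim disjE exE conjE) (simp, (rule that; assumption))
          have disj: "M + k * N = M + p * N \<or> M + k * N + N \<le> M + p * N \<or> M + p * N + N \<le> M + k * N"
            using rows_disjoint[of p k M N] p by auto
          have r18: "r2 18 = M + p * N"
            using r2 p by simp
          have post: "Inv k r3 m3" if frame4: "\<forall>x<19. r3 x = r2 x" and m3: "m3 =
              (\<lambda>a. if M + k * N \<le> a \<and> a < M + k * N + N
                then bxor (m' a) (m' (M + p * N + (a - (M + k * N)))) else m' a)" for r3 m3
          proof -
            have rows3: "rows M N m3 q a = ((rows M N m')(k := \<lambda>a. rows M N m' k a + rows M N m' p a)) q a"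
              if "a < N" for q a
              using rows_xor_row[OF that, of m3 M k m' p q] by (simp add: m3)
            have "f (rows M N m3 k) = f (rows M N m' k) + f (rows M N m' p)"
              using cols M by (simp add: f_def rows3 ac_simps)
            then have "f (rows M N m3 k) = 0"
              using fk p by simp
            moreover have "f (rows M N m3 q) = f (rows M N m' q)" if "q \<noteq> k" for q
              using cols M that by (simp add: f_def rows3)
            ultimately have "scanned k (M + p * N) m3"
              unfolding scanned_def using p others
              unfolding le_iff by (intro disjI2 exI[of _ p]) auto
            moreover have "bounded_mem m0 M m3"
              by (rule bounded_mem_xor[OF bm]) (simp add: m3)
            moreover have "row_span N (rows M N m3) = S"
            proof -
              have "row_span N (rows M N m3) =
                  row_span N ((rows M N m')(k := \<lambda>a. rows M N m' k a + rows M N m' p a))"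
                by (rule row_span_cong) (rule rows3)
              also have "\<dots> = S"
                using row_span_add_row[of p N k "rows M N m'"] k p span by simp
              finally show ?thesis .
            qed
            ultimately show ?thesis
              using frame4 frame3 k r18 by (simp add: Inv_def r2)
          qed
          have "wp xor_row (\<lambda>t (r3, m3). t \<le> 10 * N + 2 \<and> (\<forall>x<19. r3 x = r2 x) \<and> m3 =
              (\<lambda>a. if M + k * N \<le> a \<and> a < M + k * N + N
                then bxor (m' a) (m' (M + p * N + (a - (M + k * N)))) else m' a)) (r2, m')"
            by (rule wp_xor_row) (use r2 r18 disj in auto)
          then show ?thesis
            using False F by (simp add: r2 m2 t) (erule wp_mono, use post in auto)
        qed
      qed
    qed
    then show ?thesis
      unfolding row_step_def by (simp add: r' r1_def ac_simps)
  qed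
  have init: "Inv N (r(16 := N, 17 := M + N * N, 18 := 0)) m"
    using mem by (simp add: Inv_def S_def scanned_def)
  have "wp (WhileNZ 16 row_step) (\<lambda>t (r', m'). t \<le> (10 * N + 39 + 1) * N + 1 \<and> Inv 0 r' m')
      (r(16 := N, 17 := M + N * N, 18 := 0), m)"
    by (rule wp_WhileNZ_countdown[where P = Inv, OF init _ step]) (auto simp: Inv_def)
  then have "wp (WhileNZ 16 row_step) (\<lambda>t. wp (IfNZ 18 (seq [Add 17 18 4, xor_row]) (Set 21 0))
      (\<lambda>t' (r', m'). 3 + t + t' \<le> (10 * N + 40) * N + 10 * N + 10 \<and> (\<forall>x<16. r' x = r x) \<and>
        bounded_mem m0 M m' \<and> row_span N (rows M N m') = {x \<in> S. f x = 0}))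
      (r(16 := N, 17 := M + N * N, 18 := 0), m)"
  proof (rule wp_mono)
    fix t :: nat and r' m'
    assume "case (r', m') of (r', m') \<Rightarrow> t \<le> (10 * N + 39 + 1) * N + 1 \<and> Inv 0 r' m'"
    then have t: "t \<le> (10 * N + 40) * N + 1" and frame: "\<forall>x<16. r' x = r x" and bm: "bounded_mem m0 M m'"
      and span: "row_span N (rows M N m') = S" and dn: "scanned 0 (r' 18) m'"
      by (auto simp: Inv_def ac_simps)
    have r': "r' 1 = 1" "r' 3 = N" "r' 4 = 0"
      using frame r by auto
    show "wp (IfNZ 18 (seq [Add 17 18 4, xor_row]) (Set 21 0))
      (\<lambda>t' (r', m'). 3 + t + t' \<le> (10 * N + 40) * N + 10 * N + 10 \<and> (\<forall>x<16. r' x = r x) \<and>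
        bounded_mem m0 M m' \<and> row_span N (rows M N m') = {x \<in> S. f x = 0}) (r', m')"
    proof (cases "r' 18 = 0")
      case True
      then have "\<And>q. q < N \<Longrightarrow> f (rows M N m' q) = 0"
        using dn M unfolding scanned_def by auto
      then have "row_span N (rows M N m') = {x \<in> S. f x = 0}"
        using row_span_uncut[of "r 12" N "r 13" "r 14" "r 15" M "rows M N m'"] cols M span
        by (simp add: f_def)
      then show ?thesis
        using True t frame bm by simp
    next
      case False
      then obtain p where p: "p < N" "r' 18 = M + p * N" "f (rows M N m' p) = 1"
        and others: "\<forall>q<N. q \<noteq> p \<longrightarrow> f (rows M N m' q) = 0"
        using dn unfolding scanned_def by auto
      have "wp xor_row (\<lambda>t (r3, m3). t \<le> 10 * N + 2 \<and> (\<forall>x<19. r3 x = (r'(17 := M + p * N)) x) \<and> m3 =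
              (\<lambda>a. if M + p * N \<le> a \<and> a < M + p * N + N
                then bxor (m' a) (m' (M + p * N + (a - (M + p * N)))) else m' a)) (r'(17 := M + p * N), m')"
        by (rule wp_xor_row) (use r' p in auto)
      moreover have "bounded_mem m0 M m3 \<and> row_span N (rows M N m3) = {x \<in> S. f x = 0}"
        if m3: "m3 = (\<lambda>a. if M + p * N \<le> a \<and> a < M + p * N + N
                then bxor (m' a) (m' (M + p * N + (a - (M + p * N)))) else m' a)" for m3
      proof
        show "bounded_mem m0 M m3"
          by (rule bounded_mem_xor[OF bm]) (simp add: m3)
        have "rows M N m3 q a = ((rows M N m')(p := \<lambda>a. 0)) q a" if "a < N" for q a
          using rows_xor_row[OF that, of m3 M p m' p q] by (simp add: m3)
        then have "row_span N (rows M N m3) = row_span N ((rows M N m')(p := \<lambda>a. 0))"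
          by (intro row_span_cong)
        also have "\<dots> = {x \<in> S. f x = 0}"
          using row_span_cut[of p N "r 12" "r 13" "r 14" "r 15" M "rows M N m'"] cols M span p others
          unfolding f_def by blast
        finally show "row_span N (rows M N m3) = {x \<in> S. f x = 0}" .
      qed
      ultimately show ?thesis
        using False t frame p r' by (simp add: ac_simps) (erule wp_mono, auto)
    qed
  qed
  then show ?thesis
    unfolding pass_def S_def by (simp add: r ac_simps)
qed

section \<open>Running through all walk equations\<close>

text \<open>The homogenised walk equation: the right-hand side 1 has become the unknown
  \<open>x (n * n)\<close>. Indices start at 0, and \<open>m0\<close> is the input memory, whose
  matrix cells stay untouched.\<close>

definition walk_eq :: "nat \<Rightarrow> (nat \<Rightarrow> nat) \<Rightarrow> nat \<Rightarrow> nat \<Rightarrow> nat \<Rightarrow> (nat \<Rightarrow> bit) \<Rightarrow> bool" where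
  "walk_eq n m0 i j k x \<longleftrightarrow> (m0 (i * n + j) \<noteq> 0 \<longrightarrow> m0 (j * n + k) \<noteq> 0 \<longrightarrow>
     x (i * n + j) + x (j * n + k) + x (i * n + k) + x (k * n + i) + x (n * n) = 0)"

definition dims :: "nat \<Rightarrow> (nat \<Rightarrow> nat) \<Rightarrow> bool" where
  "dims n r \<longleftrightarrow> r 0 = n \<and> r 1 = 1 \<and> r 2 = n * n \<and> r 3 = n * n + 1 \<and> r 4 = 0 \<and>
     r 5 = n * n + (n * n + 1) * (n * n + 1)"

lemma dims_cong: "dims n r \<Longrightarrow> \<forall>x<6. r' x = r x \<Longrightarrow> dims n r'"
  by (simp add: dims_def)

definition solutions :: "nat \<Rightarrow> (nat \<Rightarrow> nat) \<Rightarrow> (nat \<Rightarrow> bit) set" where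
  "solutions n m = row_span (n * n + 1) (rows (n * n) (n * n + 1) m)"

definition pass_time :: "nat \<Rightarrow> nat" where
  "pass_time n = (10 * (n * n + 1) + 40) * (n * n + 1) + 10 * (n * n + 1) + 10"

lemma index_less: "i < n \<Longrightarrow> j < n \<Longrightarrow> i * n + j < n * (n :: nat)"
  by (metis (full_types) div_less_iff_less_mult div_mult_self3 div_less add.right_neutral
      less_nat_zero_code mult.commute not_gr_zero)

text \<open>For want of multiplication, the multiples of \<open>n\<close> are carried along with the
  counters and decreased by register 0. The column of an unknown is also the address of its
  adjacency bit, so registers 12 and 13 double as addresses for the arc tests.\<close>

definition k_step :: prog where
  "k_step = seq [Sub 10 10 1, Sub 11 11 0, Add 12 7 8, Add 13 9 10, Add 14 7 10, Add 15 11 6,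
     Load 21 12, IfNZ 21 (seq [Load 21 13, IfNZ 21 pass (Set 21 0)]) (Set 21 0)]"

lemma wp_k_step:
  assumes dims: "dims n r" and ijk: "i < n" "j < n" "k < n"
    and r: "r 6 = i" "r 7 = i * n" "r 8 = j" "r 9 = j * n" "r 10 = Suc k" "r 11 = Suc k * n"
    and mem: "bounded_mem m0 (n * n) m"
  shows "wp k_step (\<lambda>t (r', m'). t \<le> pass_time n + 10 \<and> (\<forall>x<10. r' x = r x) \<and>
    r' 10 = k \<and> r' 11 = k * n \<and> bounded_mem m0 (n * n) m' \<and>
    solutions n m' = {x \<in> solutions n m. walk_eq n m0 i j k x}) (r, m)"
proof -
  have d: "r 0 = n" "r 1 = 1" "r 2 = n * n" "r 3 = n * n + 1" "r 4 = 0"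
      "r 5 = n * n + (n * n + 1) * (n * n + 1)"
    using dims by (simp_all add: dims_def)
  have m: "m (i * n + j) = m0 (i * n + j)" "m (j * n + k) = m0 (j * n + k)"
    using mem ijk by (simp_all add: bounded_mem_def index_less)
  define r1 where "r1 = r(10 := k, 11 := k * n, 12 := i * n + j, 13 := j * n + k,
    14 := i * n + k, 15 := k * n + i, 21 := m (j * n + k))"
  have trivial: "solutions n m = {x \<in> solutions n m. walk_eq n m0 i j k x}"
    if "m0 (i * n + j) = 0 \<or> m0 (j * n + k) = 0"
    using that by (auto simp: walk_eq_def)
  have "wp pass (\<lambda>t (r', m'). t \<le> pass_time n \<and> (\<forall>x<16. r' x = r1 x) \<and>
      bounded_mem m0 (n * n) m' \<and>
      solutions n m' = {x \<in> solutions n m. walk_eq n m0 i j k x}) (r1, m)"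
    if nz: "m0 (i * n + j) \<noteq> 0" "m0 (j * n + k) \<noteq> 0"
  proof -
    have r1: "r1 1 = 1" "r1 2 = n * n" "r1 3 = n * n + 1" "r1 4 = 0"
      "r1 5 = n * n + (n * n + 1) * (n * n + 1)"
      "r1 12 = i * n + j" "r1 13 = j * n + k" "r1 14 = i * n + k" "r1 15 = k * n + i"
      by (simp_all add: r1_def d)
    have eq: "walk_eq n m0 i j k x \<longleftrightarrow>
        x (r1 12) + x (r1 13) + x (r1 14) + x (r1 15) + x (n * n) = 0" for x
      using nz by (simp add: walk_eq_def r1)
    have lt: "i * n + j < n * n + 1" "j * n + k < n * n + 1" "i * n + k < n * n + 1" "k * n + i < n * n + 1"
      "0 < n * n"
      using ijk index_less[of i n j] index_less[of j n k] index_less[of i n k] index_less[of k n i]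
      by auto
    show ?thesis
      unfolding eq solutions_def pass_time_def
      by (rule wp_pass) (use r1 lt mem in simp_all)
  qed
  note pass = this
  consider "m0 (i * n + j) = 0" | "m0 (i * n + j) \<noteq> 0" "m0 (j * n + k) = 0"
    | "m0 (i * n + j) \<noteq> 0" "m0 (j * n + k) \<noteq> 0"
    by blast
  then show ?thesis
  proof cases
    case 1
    then show ?thesis
      using trivial mem by (simp add: k_step_def d r m)
  next
    case 2
    then show ?thesis
      using trivial mem by (simp add: k_step_def d r m pass_time_def)
  next
    case 3
    from pass[OF this] have "wp pass (\<lambda>t (r', m'). 10 + t \<le> pass_time n + 10 \<and>
      (\<forall>x<10. r' x = r x) \<and> r' 10 = k \<and> r' 11 = k * n \<and> bounded_mem m0 (n * n) m' \<and>
      solutions n m' = {x \<in> solutions n m. walk_eq n m0 i j k x}) (r1, m)"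
      by (rule wp_mono) (auto simp: r1_def)
    with 3 show ?thesis
      by (simp add: k_step_def d r m r1_def)
  qed
qed

definition j_step :: prog where
  "j_step = seq [Sub 8 8 1, Sub 9 9 0, Add 10 0 4, Add 11 2 4, WhileNZ 10 k_step]"

lemma wp_j_step:
  assumes dims: "dims n r" and ij: "i < n" "j < n"
    and r: "r 6 = i" "r 7 = i * n" "r 8 = Suc j" "r 9 = Suc j * n"
    and mem: "bounded_mem m0 (n * n) m"
  shows "wp j_step (\<lambda>t (r', m'). t \<le> (pass_time n + 11) * n + 5 \<and> (\<forall>x<8. r' x = r x) \<and>
    r' 8 = j \<and> r' 9 = j * n \<and> bounded_mem m0 (n * n) m' \<and>
    solutions n m' = {x \<in> solutions n m. \<forall>k<n. walk_eq n m0 i j k x}) (r, m)"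
proof -
  have d: "r 0 = n" "r 1 = 1" "r 2 = n * n" "r 4 = 0"
    using dims by (simp_all add: dims_def)
  \<comment> \<open>The counter runs downwards, so the equations already imposed are those with
    index at least \<open>k\<close>. The two outer loops have the same form.\<close>
  define Inv where "Inv k r' m' \<longleftrightarrow> r' 10 = k \<and> r' 11 = k * n \<and> (\<forall>x<8. r' x = r x) \<and>
      r' 8 = j \<and> r' 9 = j * n \<and> bounded_mem m0 (n * n) m' \<and>
      solutions n m' = {x \<in> solutions n m. \<forall>k'<n. k \<le> k' \<longrightarrow> walk_eq n m0 i j k' x}"
    for k and r' m' :: "nat \<Rightarrow> nat"
  have step: "wp k_step (\<lambda>t (r', m'). t \<le> pass_time n + 10 \<and> Inv k r' m') (r', m')"
    if k: "k < n" and I: "Inv (Suc k) r' m'" for k r' m'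
  proof -
    have dims': "dims n r'"
      by (rule dims_cong[OF dims]) (use I in \<open>simp add: Inv_def\<close>)
    have "r' 6 = i" "r' 7 = i * n" "r' 8 = j" "r' 9 = j * n" "r' 10 = Suc k" "r' 11 = Suc k * n"
      and mem': "bounded_mem m0 (n * n) m'"
      using I r by (simp_all add: Inv_def)
    from wp_k_step[OF dims' ij k this] show ?thesis
    proof (rule wp_mono)
      fix t :: nat and r2 m2
      assume post: "case (r2, m2) of (r2, m2) \<Rightarrow> t \<le> pass_time n + 10 \<and> (\<forall>x<10. r2 x = r' x) \<and>
        r2 10 = k \<and> r2 11 = k * n \<and> bounded_mem m0 (n * n) m2 \<and>
        solutions n m2 = {x \<in> solutions n m'. walk_eq n m0 i j k x}"
      have le_iff: "k \<le> k' \<longleftrightarrow> k' = k \<or> Suc k \<le> k'" for k'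
        by auto
      have "solutions n m2 = {x \<in> solutions n m. \<forall>k'<n. k \<le> k' \<longrightarrow> walk_eq n m0 i j k' x}"
        using post I k unfolding Inv_def le_iff by auto
      then show "case (r2, m2) of (r2, m2) \<Rightarrow> t \<le> pass_time n + 10 \<and> Inv k r2 m2"
        using post I by (simp add: Inv_def)
    qed
  qed
  have init: "Inv n (r(8 := j, 9 := j * n, 10 := n, 11 := n * n)) m"
    using mem by (simp add: Inv_def)
  have "wp (WhileNZ 10 k_step) (\<lambda>t (r', m'). t \<le> (pass_time n + 10 + 1) * n + 1 \<and> Inv 0 r' m')
      (r(8 := j, 9 := j * n, 10 := n, 11 := n * n), m)"
    by (rule wp_WhileNZ_countdown[where P = Inv, OF init _ step]) (simp add: Inv_def)
  then show ?thesis
    unfolding j_step_def by (simp add: d r) (erule wp_mono, simp add: Inv_def ac_simps)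
qed

definition i_step :: prog where
  "i_step = seq [Sub 6 6 1, Sub 7 7 0, Add 8 0 4, Add 9 2 4, WhileNZ 8 j_step]"

lemma wp_i_step:
  assumes dims: "dims n r" and i: "i < n"
    and r: "r 6 = Suc i" "r 7 = Suc i * n"
    and mem: "bounded_mem m0 (n * n) m"
  shows "wp i_step (\<lambda>t (r', m'). t \<le> ((pass_time n + 11) * n + 6) * n + 5 \<and> (\<forall>x<6. r' x = r x) \<and>
    r' 6 = i \<and> r' 7 = i * n \<and> bounded_mem m0 (n * n) m' \<and>
    solutions n m' = {x \<in> solutions n m. \<forall>j<n. \<forall>k<n. walk_eq n m0 i j k x}) (r, m)"
proof -
  have d: "r 0 = n" "r 1 = 1" "r 2 = n * n" "r 4 = 0"
    using dims by (simp_all add: dims_def)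
  define Inv where "Inv j r' m' \<longleftrightarrow> r' 8 = j \<and> r' 9 = j * n \<and> (\<forall>x<6. r' x = r x) \<and>
      r' 6 = i \<and> r' 7 = i * n \<and> bounded_mem m0 (n * n) m' \<and>
      solutions n m' = {x \<in> solutions n m. \<forall>j'<n. j \<le> j' \<longrightarrow> (\<forall>k<n. walk_eq n m0 i j' k x)}"
    for j and r' m' :: "nat \<Rightarrow> nat"
  have step: "wp j_step (\<lambda>t (r', m'). t \<le> (pass_time n + 11) * n + 5 \<and> Inv j r' m') (r', m')"
    if j: "j < n" and I: "Inv (Suc j) r' m'" for j r' m'
  proof -
    have dims': "dims n r'"
      by (rule dims_cong[OF dims]) (use I in \<open>simp add: Inv_def\<close>)
    have "r' 6 = i" "r' 7 = i * n" "r' 8 = Suc j" "r' 9 = Suc j * n"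
      and mem': "bounded_mem m0 (n * n) m'"
      using I by (simp_all add: Inv_def)
    from wp_j_step[OF dims' i j this] show ?thesis
    proof (rule wp_mono)
      fix t :: nat and r2 m2
      assume post: "case (r2, m2) of (r2, m2) \<Rightarrow> t \<le> (pass_time n + 11) * n + 5 \<and>
        (\<forall>x<8. r2 x = r' x) \<and> r2 8 = j \<and> r2 9 = j * n \<and> bounded_mem m0 (n * n) m2 \<and>
        solutions n m2 = {x \<in> solutions n m'. \<forall>k<n. walk_eq n m0 i j k x}"
      have le_iff: "j \<le> j' \<longleftrightarrow> j' = j \<or> Suc j \<le> j'" for j'
        by auto
      have "solutions n m2 = {x \<in> solutions n m. \<forall>j'<n. j \<le> j' \<longrightarrow> (\<forall>k<n. walk_eq n m0 i j' k x)}"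
        using post I j unfolding Inv_def le_iff by auto
      then show "case (r2, m2) of (r2, m2) \<Rightarrow> t \<le> (pass_time n + 11) * n + 5 \<and> Inv j r2 m2"
        using post I by (simp add: Inv_def)
    qed
  qed
  have init: "Inv n (r(6 := i, 7 := i * n, 8 := n, 9 := n * n)) m"
    using mem by (simp add: Inv_def)
  have "wp (WhileNZ 8 j_step) (\<lambda>t (r', m'). t \<le> ((pass_time n + 11) * n + 5 + 1) * n + 1 \<and> Inv 0 r' m')
      (r(6 := i, 7 := i * n, 8 := n, 9 := n * n), m)"
    by (rule wp_WhileNZ_countdown[where P = Inv, OF init _ step]) (simp add: Inv_def)
  then show ?thesis
    unfolding i_step_def by (simp add: d r) (erule wp_mono, simp add: Inv_def ac_simps)
qed

definition solve :: prog where
  "solve = seq [Add 6 0 4, Add 7 2 4, WhileNZ 6 i_step]"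

lemma wp_solve:
  assumes dims: "dims n r" and mem: "bounded_mem m0 (n * n) m"
  shows "wp solve (\<lambda>t (r', m'). t \<le> (((pass_time n + 11) * n + 6) * n + 6) * n + 3 \<and>
    (\<forall>x<6. r' x = r x) \<and> bounded_mem m0 (n * n) m' \<and>
    solutions n m' = {x \<in> solutions n m. \<forall>i<n. \<forall>j<n. \<forall>k<n. walk_eq n m0 i j k x}) (r, m)"
proof -
  have d: "r 0 = n" "r 2 = n * n" "r 4 = 0"
    using dims by (simp_all add: dims_def)
  define Inv where "Inv i r' m' \<longleftrightarrow> r' 6 = i \<and> r' 7 = i * n \<and> (\<forall>x<6. r' x = r x) \<and>
      bounded_mem m0 (n * n) m' \<and>
      solutions n m' = {x \<in> solutions n m. \<forall>i'<n. i \<le> i' \<longrightarrow> (\<forall>j<n. \<forall>k<n. walk_eq n m0 i' j k x)}"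
    for i and r' m' :: "nat \<Rightarrow> nat"
  have step: "wp i_step (\<lambda>t (r', m'). t \<le> ((pass_time n + 11) * n + 6) * n + 5 \<and> Inv i r' m') (r', m')"
    if i: "i < n" and I: "Inv (Suc i) r' m'" for i r' m'
  proof -
    have dims': "dims n r'"
      by (rule dims_cong[OF dims]) (use I in \<open>simp add: Inv_def\<close>)
    have "r' 6 = Suc i" "r' 7 = Suc i * n" and mem': "bounded_mem m0 (n * n) m'"
      using I by (simp_all add: Inv_def)
    from wp_i_step[OF dims' i this] show ?thesis
    proof (rule wp_mono)
      fix t :: nat and r2 m2
      assume post: "case (r2, m2) of (r2, m2) \<Rightarrow> t \<le> ((pass_time n + 11) * n + 6) * n + 5 \<and>
        (\<forall>x<6. r2 x = r' x) \<and> r2 6 = i \<and> r2 7 = i * n \<and> bounded_mem m0 (n * n) m2 \<and>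
        solutions n m2 = {x \<in> solutions n m'. \<forall>j<n. \<forall>k<n. walk_eq n m0 i j k x}"
      have le_iff: "i \<le> i' \<longleftrightarrow> i' = i \<or> Suc i \<le> i'" for i'
        by auto
      have "solutions n m2 =
          {x \<in> solutions n m. \<forall>i'<n. i \<le> i' \<longrightarrow> (\<forall>j<n. \<forall>k<n. walk_eq n m0 i' j k x)}"
        using post I i unfolding Inv_def le_iff by auto
      then show "case (r2, m2) of (r2, m2) \<Rightarrow> t \<le> ((pass_time n + 11) * n + 6) * n + 5 \<and> Inv i r2 m2"
        using post I by (simp add: Inv_def)
    qed
  qed
  have init: "Inv n (r(6 := n, 7 := n * n)) m"
    using mem by (simp add: Inv_def)
  have "wp (WhileNZ 6 i_step) (\<lambda>t (r', m'). t \<le> (((pass_time n + 11) * n + 6) * n + 5 + 1) * n + 1 \<and>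
      Inv 0 r' m') (r(6 := n, 7 := n * n), m)"
    by (rule wp_WhileNZ_countdown[where P = Inv, OF init _ step]) (simp add: Inv_def)
  then show ?thesis
    unfolding solve_def by (simp add: d) (erule wp_mono, simp add: Inv_def ac_simps)
qed

section \<open>Starting from the unit matrix\<close>

text \<open>\<open>n * n\<close> is built by repeated addition. Diagonal cells are
  \<open>N + 1\<close> apart, so after \<open>N\<close> of them register 5 has run \<open>N\<close>
  past the end of the matrix; the last subtraction corrects this.\<close>

definition init :: prog where
  "init = seq [Set 1 1, Add 6 0 4, WhileNZ 6 (seq [Sub 6 6 1, Add 2 2 0]),
     Add 3 2 1, Add 5 2 4, Add 6 3 4,
     WhileNZ 6 (seq [Sub 6 6 1, Store 5 1, Add 5 5 1, Add 5 5 3]), Sub 5 5 3]"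

lemma wp_square_loop:
  assumes "r 0 = n" "r 1 = 1" "r 2 = 0" "r 3 = 0" "r 4 = 0" "r 6 = n"
  shows "wp (WhileNZ 6 (seq [Sub 6 6 1, Add 2 2 0]))
    (\<lambda>t (r', m'). t \<le> 3 * n + 1 \<and> m' = m \<and> r' 0 = n \<and> r' 1 = 1 \<and> r' 2 = n * n \<and> r' 4 = 0) (r, m)"
proof -
  define Inv where "Inv k r' m' \<longleftrightarrow> m' = m \<and> r' 0 = n \<and> r' 1 = 1 \<and> r' 2 + k * n = n * n \<and>
    r' 4 = 0 \<and> r' 6 = k" for k and r' m' :: "nat \<Rightarrow> nat"
  have start: "Inv n r m"
    using assms by (simp add: Inv_def)
  have "wp (WhileNZ 6 (seq [Sub 6 6 1, Add 2 2 0]))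
    (\<lambda>t (r', m'). t \<le> (2 + 1) * n + 1 \<and> Inv 0 r' m') (r, m)"
    by (rule wp_WhileNZ_countdown[where P = Inv, OF start]) (auto simp: Inv_def)
  then show ?thesis
    by (rule wp_mono) (simp add: Inv_def)
qed

lemma wp_diagonal_loop:
  assumes "r 0 = n" "r 1 = 1" "r 2 = M" "r 3 = N" "r 4 = 0" "r 5 = M" "r 6 = N"
  shows "wp (WhileNZ 6 (seq [Sub 6 6 1, Store 5 1, Add 5 5 1, Add 5 5 3]))
    (\<lambda>t (r', m'). t \<le> 5 * N + 1 \<and> (\<forall>x<5. r' x = r x) \<and> r' 5 = M + N * N + N \<and>
      m' = (\<lambda>a. if \<exists>q<N. a = M + q * N + q then 1 else m a)) (r, m)"
proof -
  define Inv where "Inv k r' m' \<longleftrightarrow> r' 6 = k \<and> (\<forall>x<5. r' x = r x) \<and> (\<exists>p. p + k = N \<and>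
    r' 5 = M + p * N + p \<and> m' = (\<lambda>a. if \<exists>q<p. a = M + q * N + q then 1 else m a))"
    for k and r' m' :: "nat \<Rightarrow> nat"
  have start: "Inv N r m"
    using assms by (simp add: Inv_def)
  have step: "wp (seq [Sub 6 6 1, Store 5 1, Add 5 5 1, Add 5 5 3])
      (\<lambda>t (r', m'). t \<le> 4 \<and> Inv k r' m') (r', m')" if I: "Inv (Suc k) r' m'" for k r' m'
  proof -
    from I obtain p where p: "p + Suc k = N" "r' 5 = M + p * N + p"
      and m': "m' = (\<lambda>a. if \<exists>q<p. a = M + q * N + q then 1 else m a)"
      by (auto simp: Inv_def)
    have r': "r' 1 = 1" "r' 3 = N" "r' 6 = Suc k" and frame: "\<forall>x<5. r' x = r x"
      using I assms by (auto simp: Inv_def)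
    have "m'(M + p * N + p := 1) = (\<lambda>a. if \<exists>q<Suc p. a = M + q * N + q then 1 else m a)"
      by (rule ext) (auto simp: m' less_Suc_eq)
    then show ?thesis
      using p(1) frame by (auto simp: Inv_def p(2) r' intro!: exI[of _ "Suc p"])
  qed
  have "wp (WhileNZ 6 (seq [Sub 6 6 1, Store 5 1, Add 5 5 1, Add 5 5 3]))
    (\<lambda>t (r', m'). t \<le> (4 + 1) * N + 1 \<and> Inv 0 r' m') (r, m)"
    by (rule wp_WhileNZ_countdown[where P = Inv, OF start _ step]) (auto simp: Inv_def)
  then show ?thesis
    by (rule wp_mono) (auto simp: Inv_def)
qed

lemma wp_init:
  assumes "\<And>a. m a \<le> 1" "\<And>a. n * n \<le> a \<Longrightarrow> m a = 0"
  shows "wp init (\<lambda>t (r', m'). t \<le> 5 * (n * n + 1) + 3 * n + 8 \<and> dims n r' \<and>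
    bounded_mem m (n * n) m' \<and> solutions n m' = UNIV) ((\<lambda>_. 0)(0 := n), m)"
proof -
  let ?N = "n * n + 1"
  have mem: "bounded_mem m (n * n) m' \<and> solutions n m' = UNIV"
    if m': "m' = (\<lambda>a. if \<exists>q<?N. a = n * n + q * ?N + q then 1 else m a)" for m'
  proof
    show "bounded_mem m (n * n) m'"
      using assms(1) by (auto simp: bounded_mem_def m')
    have "rows (n * n) ?N m' q a = of_bool (a = q)" if "q < ?N" "a < ?N" for q a
    proof -
      \<comment> \<open>Both \<open>a\<close> and \<open>q'\<close> are below \<open>?N\<close>, so
        division with remainder by \<open>?N\<close> recovers row and column from the
        address.\<close>
      have "(\<exists>q'<?N. n * n + q * ?N + a = n * n + q' * ?N + q') \<longleftrightarrow> a = q"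
      proof
        assume "\<exists>q'<?N. n * n + q * ?N + a = n * n + q' * ?N + q'"
        then obtain q' where q': "q' < ?N" "a + q * ?N = q' + q' * ?N"
          by (auto simp: add.commute)
        then have "(a + q * ?N) mod ?N = (q' + q' * ?N) mod ?N" "(a + q * ?N) div ?N = (q' + q' * ?N) div ?N"
          by (simp_all only:)
        then show "a = q"
          using that q'(1) by (simp only: mod_mult_self1 div_mult_self1 mod_less div_less)
      qed (use that in auto)
      then show ?thesis
        using assms(2)[of "n * n + q * ?N + a"] by (simp add: rows_def m')
    qed
    then have "row_span ?N (rows (n * n) ?N m') = row_span ?N (\<lambda>q a. of_bool (a = q))"
      by (rule row_span_cong)
    then show "solutions n m' = UNIV"
      unfolding solutions_def row_span_unit_rows .
  qed
  let ?Q = "\<lambda>t (r', m'). t \<le> 5 * (n * n + 1) + 3 * n + 8 \<and> dims n r' \<and>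
    bounded_mem m (n * n) m' \<and> solutions n m' = UNIV"
  have diag: "wp (WhileNZ 6 (seq [Sub 6 6 1, Store 5 1, Add 5 5 1, Add 5 5 3]))
      (\<lambda>t'. wp (Sub 5 5 3) (\<lambda>t''. ?Q (5 + t + t' + t'')))
      (r(3 := ?N, 5 := n * n, 6 := ?N), m)"
    if t: "t \<le> 3 * n + 1" and r: "r 0 = n" "r 1 = 1" "r 2 = n * n" "r 4 = 0" for t r
  proof (rule wp_mono[OF wp_diagonal_loop[of _ n "n * n" ?N]])
    fix t' :: nat and r2 m2
    assume "case (r2, m2) of (r2, m2) \<Rightarrow> t' \<le> 5 * ?N + 1 \<and>
      (\<forall>x<5. r2 x = (r(3 := ?N, 5 := n * n, 6 := ?N)) x) \<and> r2 5 = n * n + ?N * ?N + ?N \<and>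
      m2 = (\<lambda>a. if \<exists>q<?N. a = n * n + q * ?N + q then 1 else m a)"
    then have t': "t' \<le> 5 * ?N + 1" and frame: "\<forall>x<5. r2 x = (r(3 := ?N, 5 := n * n, 6 := ?N)) x"
      and r5: "r2 5 = n * n + ?N * ?N + ?N"
      and m2: "m2 = (\<lambda>a. if \<exists>q<?N. a = n * n + q * ?N + q then 1 else m a)"
      by blast+
    have "dims n (r2(5 := r2 5 - r2 3))"
      using frame r unfolding dims_def r5 by simp
    then show "wp (Sub 5 5 3) (\<lambda>t''. ?Q (5 + t + t' + t'')) (r2, m2)"
      using mem[OF m2] t t' by simp
  qed (use r in simp_all)
  have "wp (WhileNZ 6 (seq [Sub 6 6 1, Add 2 2 0])) (\<lambda>t.
      wp (seq [Add 3 2 1, Add 5 2 4, Add 6 3 4,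
        WhileNZ 6 (seq [Sub 6 6 1, Store 5 1, Add 5 5 1, Add 5 5 3]), Sub 5 5 3])
      (\<lambda>t'. ?Q (2 + t + t'))) ((\<lambda>_. 0)(0 := n, 1 := 1, 6 := n), m)"
    by (rule wp_mono[OF wp_square_loop[of _ n]]) (use diag in \<open>auto simp: ac_simps\<close>)
  then show ?thesis
    unfolding init_def by (simp add: ac_simps)
qed

section \<open>Reading off the answer\<close>

definition verdict :: prog where
  "verdict = seq [Set 0 1, Add 6 3 4, Add 7 5 4,
     WhileNZ 6 (seq [Sub 6 6 1, Sub 7 7 3, Add 21 7 2, Load 21 21, IfNZ 21 (Set 0 0) (Set 21 0)])]"

lemma all_ge_iff: "k < N \<Longrightarrow> (\<forall>q<N. k \<le> q \<longrightarrow> Z q) \<longleftrightarrow> Z k \<and> (\<forall>q<N. Suc k \<le> q \<longrightarrow> Z q)"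
  by (auto simp: Suc_le_eq le_less)

text \<open>A coordinate vanishes on a span iff it vanishes on the spanning rows, so it suffices to
  inspect the last column.\<close>

lemma wp_verdict:
  assumes dims: "dims n r" and mem: "bounded_mem m0 (n * n) m"
  shows "wp verdict (\<lambda>t (r', m'). t \<le> 7 * (n * n + 1) + 4 \<and>
    (r' 0 \<noteq> 0 \<longleftrightarrow> (\<forall>x \<in> solutions n m. x (n * n) = 0))) (r, m)"
proof -
  let ?M = "n * n" and ?N = "n * n + 1"
  have d: "r 1 = 1" "r 2 = ?M" "r 3 = ?N" "r 4 = 0" "r 5 = ?M + ?N * ?N"
    using dims by (simp_all add: dims_def)
  define Inv where "Inv k r' m' \<longleftrightarrow> m' = m \<and> r' 1 = 1 \<and> r' 2 = ?M \<and> r' 3 = ?N \<and> r' 6 = k \<and>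
    r' 7 = ?M + k * ?N \<and> (r' 0 \<noteq> 0 \<longleftrightarrow> (\<forall>q<?N. k \<le> q \<longrightarrow> m (?M + q * ?N + ?M) = 0))"
    for k and r' m' :: "nat \<Rightarrow> nat"
  have start: "Inv ?N (r(0 := 1, 6 := ?N, 7 := ?M + ?N * ?N)) m"
    by (simp add: Inv_def d)
  have step: "wp (seq [Sub 6 6 1, Sub 7 7 3, Add 21 7 2, Load 21 21, IfNZ 21 (Set 0 0) (Set 21 0)])
      (\<lambda>t (r', m'). t \<le> 6 \<and> Inv k r' m') (r', m')" if k: "k < ?N" and I: "Inv (Suc k) r' m'" for k r' m'
  proof -
    have r': "r' 1 = 1" "r' 2 = ?M" "r' 3 = ?N" "r' 6 = Suc k" "r' 7 = ?M + Suc k * ?N" "m' = m"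
      and acc: "r' 0 \<noteq> 0 \<longleftrightarrow> (\<forall>q<?N. Suc k \<le> q \<longrightarrow> m (?M + q * ?N + ?M) = 0)"
      using I unfolding Inv_def by blast+
    have acc': "(\<forall>q<?N. k \<le> q \<longrightarrow> m (?M + q * ?N + ?M) = 0) \<longleftrightarrow> m (?M + k * ?N + ?M) = 0 \<and> r' 0 \<noteq> 0"
      unfolding acc by (rule all_ge_iff[OF k])
    have "?M + Suc k * ?N - ?N = ?M + k * ?N"
      by simp
    then show ?thesis
      unfolding Inv_def acc' by (simp add: r' del: mult_Suc)
  qed
  have loop: "wp (WhileNZ 6 (seq [Sub 6 6 1, Sub 7 7 3, Add 21 7 2, Load 21 21, IfNZ 21 (Set 0 0) (Set 21 0)]))
    (\<lambda>t (r', m'). t \<le> (6 + 1) * ?N + 1 \<and> Inv 0 r' m') (r(0 := 1, 6 := ?N, 7 := ?M + ?N * ?N), m)"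
    by (rule wp_WhileNZ_countdown[where P = Inv, OF start _ step]) (simp_all add: Inv_def)
  have zero_iff: "m (?M + q * ?N + ?M) = 0 \<longleftrightarrow> rows ?M ?N m q ?M = 0" for q
  proof -
    have "m (?M + q * ?N + ?M) \<in> {0, 1}"
      using mem unfolding bounded_mem_def by (metis insertCI le_neq_implies_less less_one)
    then show ?thesis
      by (auto simp: rows_def)
  qed
  have "(\<forall>q<?N. m (?M + q * ?N + ?M) = 0) \<longleftrightarrow> (\<forall>x \<in> solutions n m. x ?M = 0)"
    unfolding zero_iff
  proof
    assume z: "\<forall>q<?N. rows ?M ?N m q ?M = 0"
    show "\<forall>x \<in> solutions n m. x ?M = 0"
    proof
      fix x assume "x \<in> solutions n m"
      then obtain c where "\<forall>a<?N. x a = (\<Sum>q<?N. c q * rows ?M ?N m q a)"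
        unfolding solutions_def row_span_def by blast
      then have "x ?M = (\<Sum>q<?N. c q * rows ?M ?N m q ?M)"
        by (metis less_add_one)
      also have "\<dots> = 0"
        using z by (intro sum.neutral) auto
      finally show "x ?M = 0" .
    qed
  next
    assume "\<forall>x \<in> solutions n m. x ?M = 0"
    then show "\<forall>q<?N. rows ?M ?N m q ?M = 0"
      unfolding solutions_def using row_span_contains_row by blast
  qed
  then show ?thesis
    using loop unfolding verdict_def
    by (simp add: d) (erule wp_mono, simp add: Inv_def)
qed

definition decide :: prog where
  "decide = seq [init, solve, verdict]"

definition run_time :: "nat \<Rightarrow> nat" where
  "run_time n = (((pass_time n + 11) * n + 6) * n + 6) * n + 12 * (n * n + 1) + 3 * n + 15"

lemma wp_decide:
  assumes "\<And>a. m a \<le> 1" "\<And>a. n * n \<le> a \<Longrightarrow> m a = 0"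
  shows "wp decide (\<lambda>t (r', m'). t \<le> run_time n \<and>
    (r' 0 \<noteq> 0 \<longleftrightarrow> (\<forall>x. (\<forall>i<n. \<forall>j<n. \<forall>k<n. walk_eq n m i j k x) \<longrightarrow> x (n * n) = 0)))
    ((\<lambda>_. 0)(0 := n), m)"
proof -
  let ?Q = "\<lambda>t (r', m'). t \<le> run_time n \<and>
    (r' 0 \<noteq> 0 \<longleftrightarrow> (\<forall>x. (\<forall>i<n. \<forall>j<n. \<forall>k<n. walk_eq n m i j k x) \<longrightarrow> x (n * n) = 0))"
  have out: "wp verdict (\<lambda>t''. ?Q (t + t' + t'')) (r, m')"
    if "t \<le> 5 * (n * n + 1) + 3 * n + 8" "t' \<le> (((pass_time n + 11) * n + 6) * n + 6) * n + 3"
      "dims n r" "bounded_mem m (n * n) m'"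
      "solutions n m' = {x. \<forall>i<n. \<forall>j<n. \<forall>k<n. walk_eq n m i j k x}" for t t' r m'
    by (rule wp_mono[OF wp_verdict[OF that(3,4)]]) (use that in \<open>auto simp: run_time_def\<close>)
  have sol: "wp solve (\<lambda>t'. wp verdict (\<lambda>t''. ?Q (t + t' + t''))) (r, m')"
    if t: "t \<le> 5 * (n * n + 1) + 3 * n + 8" "dims n r" "bounded_mem m (n * n) m'" "solutions n m' = UNIV"
    for t r m'
  proof (rule wp_mono[OF wp_solve[OF that(2,3)]])
    fix t' :: nat and r2 m2
    assume post: "case (r2, m2) of (r2, m2) \<Rightarrow> t' \<le> (((pass_time n + 11) * n + 6) * n + 6) * n + 3 \<and>
      (\<forall>x<6. r2 x = r x) \<and> bounded_mem m (n * n) m2 \<and>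
      solutions n m2 = {x \<in> solutions n m'. \<forall>i<n. \<forall>j<n. \<forall>k<n. walk_eq n m i j k x}"
    have "dims n r2"
      by (rule dims_cong[OF that(2)]) (use post in simp)
    then show "wp verdict (\<lambda>t''. ?Q (t + t' + t'')) (r2, m2)"
      using post that by (intro out) simp_all
  qed
  have "wp init (\<lambda>t. wp solve (\<lambda>t'. wp verdict (\<lambda>t''. ?Q (t + t' + t'')))) ((\<lambda>_. 0)(0 := n), m)"
    by (rule wp_mono[OF wp_init[OF assms]]) (use sol in auto)
  then show ?thesis
    unfolding decide_def by (simp add: ac_simps)
qed

section \<open>Homogeneous solutions and walk potentials\<close>

text \<open>Solutions with homogenising coordinate 1 are exactly the walk potentials, after shifting
  vertices \<open>1..n\<close> to indices from 0.\<close>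

lemma walk_eq_solvable_iff:
  assumes G: "simple_graph n E"
  shows "(\<forall>x. (\<forall>i<n. \<forall>j<n. \<forall>k<n. walk_eq n (snd (input_config n E)) i j k x) \<longrightarrow> x (n * n) = 0)
    \<longleftrightarrow> (\<nexists>w. walk_potential n E w)"
proof -
  let ?m = "snd (input_config n E)"
  have adj: "?m (i * n + j) \<noteq> 0 \<longleftrightarrow> (i + 1, j + 1) \<in> Arcs n E" if "i < n" "j < n" for i j
    using that index_less[OF that] by (simp add: input_config_def Arcs_iff[OF G])
  show ?thesis
  proof (intro iffI notI)
    assume L: "\<forall>x. (\<forall>i<n. \<forall>j<n. \<forall>k<n. walk_eq n ?m i j k x) \<longrightarrow> x (n * n) = 0"
      and "\<exists>w. walk_potential n E w"
    then obtain w where w: "walk_potential n E w"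
      by blast
    define x :: "nat \<Rightarrow> bit" where "x a = (if a = n * n then 1 else w (a div n + 1, a mod n + 1))" for a
    have x: "x (i * n + j) = w (i + 1, j + 1)" if "i < n" "j < n" for i j
      using that index_less[OF that] by (simp add: x_def)
    have "walk_eq n ?m i j k x" if "i < n" "j < n" "k < n" for i j k
      unfolding walk_eq_def
    proof (intro impI)
      assume "?m (i * n + j) \<noteq> 0" "?m (j * n + k) \<noteq> 0"
      then have "w (i + 1, j + 1) + w (j + 1, k + 1) + w (i + 1, k + 1) + w (k + 1, i + 1) = 1"
        using w that unfolding walk_potential_def by (simp only: adj)
      moreover have "x (n * n) = 1"
        by (simp add: x_def)
      ultimately show "x (i * n + j) + x (j * n + k) + x (i * n + k) + x (k * n + i) + x (n * n) = 0"
        using that by (simp only: x) simp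
    qed
    with L have "x (n * n) = 0"
      by blast
    then show False
      by (simp add: x_def)
  next
    assume no_walk: "\<nexists>w. walk_potential n E w"
    show "\<forall>x. (\<forall>i<n. \<forall>j<n. \<forall>k<n. walk_eq n ?m i j k x) \<longrightarrow> x (n * n) = 0"
    proof (intro allI impI, rule ccontr)
      fix x assume sol: "\<forall>i<n. \<forall>j<n. \<forall>k<n. walk_eq n ?m i j k x" and "x (n * n) \<noteq> 0"
      then have one: "x (n * n) = 1"
        by simp
      define w where "w = (\<lambda>(i, j). x ((i - 1) * n + (j - 1)))"
      have "walk_potential n E w"
        unfolding walk_potential_def
      proof (intro allI impI)
        fix i j k assume a: "(i, j) \<in> Arcs n E" "(j, k) \<in> Arcs n E"
        then have V: "1 \<le> i" "i - 1 < n" "1 \<le> j" "j - 1 < n" "1 \<le> k" "k - 1 < n"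
          by (auto simp: Arcs_def vertices_def)
        have "walk_eq n ?m (i - 1) (j - 1) (k - 1) x"
          using sol V by blast
        moreover have "?m ((i - 1) * n + (j - 1)) \<noteq> 0" "?m ((j - 1) * n + (k - 1)) \<noteq> 0"
          using a V by (simp_all only: adj le_add_diff_inverse2)
        ultimately have "w (i, j) + w (j, k) + w (i, k) + w (k, i) + 1 = 0"
          by (simp only: walk_eq_def w_def case_prod_conv one) blast
        then show "w (i, j) + w (j, k) + w (i, k) + w (k, i) = 1"
          by simp
      qed
      with no_walk show False
        by blast
    qed
  qed
qed

text \<open>The coefficients are naturals, hence nonnegative. This carries a bound in
  \<open>n\<close> over to \<open>graph_size n E\<close>, which is at least
  \<open>n\<close>.\<close>

lemma poly_nat_mono: "x \<le> y \<Longrightarrow> poly p x \<le> poly p (y :: nat)"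
  by (induction p) (auto intro!: add_mono mult_mono)

lemma run_time_poly: "\<exists>b. \<forall>n. run_time n = poly b n"
proof -
  define y :: "nat poly" where "y = [:0, 1:]"
  have y: "poly y n = n" for n
    by (simp add: y_def)
  show ?thesis
    by (rule exI[of _ "((((([:10:] * (y * y + 1) + [:40:]) * (y * y + 1) + [:10:] * (y * y + 1) + [:10:])
      + [:11:]) * y + [:6:]) * y + [:6:]) * y + [:12:] * (y * y + 1) + [:3:] * y + [:15:]"])
      (simp add: run_time_def pass_time_def y)
qed

lemma certificate_recognizable: "recognizable_in_polynomial_time has_degree_one_certificate"
proof -
  obtain b where b: "\<And>n. run_time n = poly b n"
    using run_time_poly by blast
  show ?thesis
    unfolding recognizable_in_polynomial_time_def
  proof (intro exI[of _ decide] exI[of _ b] allI impI)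
    fix n E assume G: "simple_graph n E"
    define m where "m = snd (input_config n E)"
    have input: "input_config n E = ((\<lambda>_. 0)(0 := n), m)"
      by (simp add: input_config_def m_def)
    have "wp decide (\<lambda>t (r', m'). t \<le> run_time n \<and> (r' 0 \<noteq> 0 \<longleftrightarrow>
        (\<forall>x. (\<forall>i<n. \<forall>j<n. \<forall>k<n. walk_eq n m i j k x) \<longrightarrow> x (n * n) = 0))) ((\<lambda>_. 0)(0 := n), m)"
      by (rule wp_decide) (auto simp: input_config_def m_def)
    then have "wp decide (\<lambda>t (r', m'). t \<le> run_time n \<and> (r' 0 \<noteq> 0 \<longleftrightarrow>
        has_degree_one_certificate n E)) (input_config n E)"
      unfolding input certificate_iff_no_walk_potential[OF G]
        walk_eq_solvable_iff[OF G, folded m_def] .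
    then obtain t r m' where run: "runs decide (input_config n E) t (r, m')" "t \<le> run_time n"
      and acc: "r 0 \<noteq> 0 \<longleftrightarrow> has_degree_one_certificate n E"
      unfolding wp_def by blast
    have "run_time n \<le> poly b (graph_size n E)"
      unfolding b by (rule poly_nat_mono) (simp add: graph_size_def vertices_def)
    with run acc show "\<exists>t r m. runs decide (input_config n E) t (r, m) \<and>
        t \<le> poly b (graph_size n E) \<and> (r 0 \<noteq> 0 \<longleftrightarrow> has_degree_one_certificate n E)"
      by (intro exI[of _ t] exI[of _ r] exI[of _ m']) simp
  qed
qed

theorem theorem2p1:
  shows "(\<forall>n E. simple_graph n E \<longrightarrow>
            (has_degree_one_certificate n E \<longleftrightarrow>
              (\<exists>C. C \<subseteq> partial_3_cycles n E \<union> chordless_4_cycles n E \<and>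
                 (\<forall>i j. {i, j} \<in> E \<longrightarrow>
                    [card (cycles_through C (i, j)) + card (cycles_through C (j, i)) = 0] (mod 2)) \<and>
                 [(\<Sum>(i, j) \<in> {(i, j) \<in> Arcs n E. i < j}. card (cycles_through C (i, j))) = 1] (mod 2))))
       \<and> recognizable_in_polynomial_time has_degree_one_certificate
       \<and> recognizable_in_polynomial_time
           (\<lambda>n E. \<not> three_colorable n E \<and> has_degree_one_certificate n E)"
proof (intro conjI allI impI)
  have cert: "has_degree_one_certificate n E \<longleftrightarrow> (\<nexists>u. arc_potential n E u)" if "simple_graph n E" for n E
    unfolding certificate_iff_no_walk_potential[OF that]
    using walk_potential_imp_arc_potential[OF that] arc_potential_imp_walk_potential[OF that] by blast
  show "has_degree_one_certificate n E \<longleftrightarrow>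
      (\<exists>C. C \<subseteq> partial_3_cycles n E \<union> chordless_4_cycles n E \<and>
        (\<forall>i j. {i, j} \<in> E \<longrightarrow>
          [card (cycles_through C (i, j)) + card (cycles_through C (j, i)) = 0] (mod 2)) \<and>
        [(\<Sum>(i, j) \<in> {(i, j) \<in> Arcs n E. i < j}. card (cycles_through C (i, j))) = 1] (mod 2))"
    if "simple_graph n E" for n E
    unfolding cert[OF that] by (rule cycle_family_iff_no_arc_potential[OF that, symmetric])
  show "recognizable_in_polynomial_time has_degree_one_certificate"
    by (rule certificate_recognizable)
  \<comment> \<open>A 3-colouring yields an arc potential, which excludes a certificate. Agreement
    on simple graphs is enough, since recognizability quantifies over these only.\<close>
  have "\<not> three_colorable n E \<and> has_degree_one_certificate n E \<longleftrightarrow> has_degree_one_certificate n E"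
    if "simple_graph n E" for n E
    using cert[OF that] three_colorable_imp_arc_potential[OF that] by blast
  then show "recognizable_in_polynomial_time
      (\<lambda>n E. \<not> three_colorable n E \<and> has_degree_one_certificate n E)"
    using certificate_recognizable unfolding recognizable_in_polynomial_time_def by simp
qed

end
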